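(* Let $K$ be an $n$-dimensional triangulated homology manifold equipped with an $h$-tiling $\tau$. Then the polynomial $$P(X)=\sum_{k=0}^{n+1} h_k(\tau)X^k+\sum_{k=2}^{n+1}c_{n+1-k}(\tau)(X-1)^k+\frac12\chi(K)(1-X)^{n+1}$$ is palindromic, i.e. $X^{n+1}P(1/X)=P(X)$.
   Context: An $n$-dimensional triangulated homology manifold is a finite simplicial complex $K$ whose geometric realization $M=|K|$ satisfies $H_*(M,M\setminus\{x\};\mathbb Z)\cong H_*(\mathbb R^n,\mathbb R^n\setminus\{0\};\mathbb Z)$ for all $x\in M$; $\chi(K)$ is its Euler characteristic. A basic tile of dimension $n$ and order $k\in\{0,\dots,n+1\}$ is an $n$-simplex deprived of $k$ of its $(n-1)$-faces; it has a unique face of least dimension $k-1$. A critical tile of dimension $n$ and index $k\in\{0,\dots,n\}$ is a basic tile of order $k$ deprived moreover of that $(k-1)$-dimensional face; its order is $k$ if $k<n$ and $n+1$ if $k=n$ (open simplex). An $h$-tiling of $K$ is a partition of $|K|$ into basic or critical tiles whose underlying simplices are simplices of $K$ such that for every $d\ge0$ the union of tiles of dimension $>d$ is closed in $|K|$. $h_j(\tau)$ is the number of tiles of order $j$ used by $\tau$ (including critical ones) and $c_j(\tau)$ the number of critical tiles of index $j$. *)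

theory Defs
  imports "HOL-Analysis.Analysis" "HOL-Homology.Homology" "HOL-Computational_Algebra.Polynomial"
begin

text \<open>Simplices and finite simplicial complexes are those of \<^const>\<open>simplicial_complex\<close>: a complex
  \<open>K\<close> is a set of geometric simplices of some Euclidean space, and its geometric realization is
  \<open>\<Union>K\<close> with the subspace topology. A nonempty \<open>K\<close> contains the empty simplex, of
  dimension \<open>-1\<close>.\<close>

definition homology_manifold :: "nat \<Rightarrow> 'a::euclidean_space set set \<Rightarrow> bool" where
  "homology_manifold n K \<longleftrightarrow>
     simplicial_complex K \<and>
     (\<forall>x\<in>\<Union>K. \<forall>p::int.
        relative_homology_group p (top_of_set (\<Union>K)) (\<Union>K - {x}) \<cong>
        relative_homology_group p (Euclidean_space n) (topspace (Euclidean_space n) - {\<lambda>i. 0}))"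

definition euler_char :: "'a::euclidean_space set set \<Rightarrow> int" where
  "euler_char K = (\<Sum>F\<in>K - {{}}. (-1) ^ nat (aff_dim F))"

text \<open>In the following two predicates \<open>d\<close> is the dimension of the tile \<open>T\<close>, \<open>S\<close> its underlying
  simplex and \<open>k\<close> its order, respectively its index. The only \<open>(-1)\<close>-dimensional face of a simplex
  is \<open>{}\<close>; in particular a critical tile of index \<open>0\<close> is a closed simplex, and for \<open>d = 0\<close> a point
  is a basic tile both of order \<open>0\<close> and of order \<open>1\<close>.\<close>

definition basic_tile :: "nat \<Rightarrow> nat \<Rightarrow> 'a::euclidean_space set \<Rightarrow> 'a set \<Rightarrow> bool" where
  "basic_tile d k S T \<longleftrightarrow>
     int d simplex S \<and>
     (\<exists>A \<subseteq> {F. F face_of S \<and> aff_dim F = int d - 1}. card A = k \<and> T = S - \<Union>A)"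

text \<open>A face \<open>F\<close> of the simplex \<open>S\<close> belongs to the tile \<open>B\<close> if the open face \<open>rel_interior F\<close> is
  contained in \<open>B\<close>; for \<open>F \<noteq> {}\<close> this says that \<open>F\<close> lies in none of the removed
  facets. A basic tile of order \<open>k\<close> has exactly one such face of dimension \<open>k - 1\<close>.\<close>

definition critical_tile :: "nat \<Rightarrow> nat \<Rightarrow> 'a::euclidean_space set \<Rightarrow> 'a set \<Rightarrow> bool" where
  "critical_tile d k S T \<longleftrightarrow>
     k \<le> d \<and>
     (\<exists>B F. basic_tile d k S B \<and> F face_of S \<and> aff_dim F = int k - 1 \<and> rel_interior F \<subseteq> B \<and>
            T = B - F)"

definition tile :: "nat \<Rightarrow> 'a::euclidean_space set \<Rightarrow> 'a set \<Rightarrow> bool" where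
  "tile d S T \<longleftrightarrow> (\<exists>k. basic_tile d k S T \<or> critical_tile d k S T)"

text \<open>Some tiles are both basic and critical, namely closed and open simplices. The two ways of
  reading off the order agree when \<open>d > 0\<close>. For \<open>d = 0\<close> they do not, and the point, critical
  of index \<open>0 = d\<close>, gets the order \<open>d + 1 = 1\<close> of an open simplex.\<close>

definition has_order :: "'a::euclidean_space set \<Rightarrow> nat \<Rightarrow> bool" where
  "has_order T j \<longleftrightarrow>
     (if \<exists>d k S. critical_tile d k S T
      then \<exists>d k S. critical_tile d k S T \<and> j = (if k < d then k else d + 1)
      else \<exists>d S. basic_tile d j S T)"

definition h_tiling :: "'a::euclidean_space set set \<Rightarrow> 'a set set \<Rightarrow> bool" where
  "h_tiling K \<tau> \<longleftrightarrow>
     partition_on (\<Union>K) \<tau> \<and>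
     (\<forall>T\<in>\<tau>. \<exists>d. \<exists>S\<in>K. tile d S T) \<and>
     (\<forall>d. closedin (top_of_set (\<Union>K)) (\<Union>{T\<in>\<tau>. \<exists>e>d. \<exists>S\<in>K. tile e S T}))"

definition h_num :: "'a::euclidean_space set set \<Rightarrow> nat \<Rightarrow> nat" where
  "h_num \<tau> j = card {T\<in>\<tau>. has_order T j}"

text \<open>Every closed simplex of the tiling counts as critical of index \<open>0\<close>.\<close>

definition c_num :: "'a::euclidean_space set set \<Rightarrow> nat \<Rightarrow> nat" where
  "c_num \<tau> j = card {T\<in>\<tau>. \<exists>d S. critical_tile d j S T}"

definition tiling_poly :: "nat \<Rightarrow> 'a::euclidean_space set set \<Rightarrow> 'a set set \<Rightarrow> real poly" where
  "tiling_poly n K \<tau> =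
     (\<Sum>k=0..n+1. Polynomial.smult (real (h_num \<tau> k)) ([:0, 1:] ^ k)) +
     (\<Sum>k=2..n+1. Polynomial.smult (real (c_num \<tau> (n + 1 - k))) ([:-1, 1:] ^ k)) +
     Polynomial.smult (1/2 * of_int (euler_char K)) ([:1, -1:] ^ (n + 1))"

end

theory Submission
  imports Defs
begin

text \<open>The relation between open faces and tiles expresses the face polynomial
  \<open>f y = (\<Sum>F. y ^ (dim F + 1))\<close> of \<open>K\<close> through the numbers \<open>h\<^sub>j\<close> and \<open>c\<^sub>j\<close>, so the theorem
  reduces to the Dehn-Sommerville relation
  \<open>f (-1 - y) = - (-1) ^ n * f y - \<chi>\<close>. This one follows from the identity
  \<open>(\<Sum>G \<supseteq> F. (-1) ^ dim G) = (-1) ^ n\<close> for all nonempty faces \<open>F\<close>, which is the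
  Euler characteristic of the pair \<open>(M, M - {x})\<close> for \<open>x\<close> in the open face \<open>F\<close>: the space
  \<open>M - {x}\<close> retracts onto the subcomplex of the simplices that do not contain \<open>F\<close>, and
  singular and combinatorial Euler characteristic agree for complexes. The local homology at
  interior points of maximal simplices also shows that all maximal simplices have dimension
  \<open>n\<close>, and then the openness condition on tilings leaves only tiles of dimension
  \<open>n\<close>.\<close>

subsection \<open>Rank of abelian groups\<close>

text \<open>The terms of \<open>tiling_poly\<close> are dictated by how tiles count open faces. A
  tile of positive order \<open>k\<close> in an \<open>n\<close>-simplex consists of the open faces
  whose vertices include \<open>k\<close> fixed ones and adds
  \<open>y ^ k * (1 + y) ^ (n + 1 - k)\<close> to f; criticality of index \<open>k\<close> removes
  the least face and hence \<open>y ^ k\<close>. For \<open>k = n\<close> this leaves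
  \<open>y ^ (n + 1)\<close>, the share of order \<open>n + 1\<close>, so only indices below
  \<open>n\<close> need a correction. In the variable X that correction is
  \<open>X ^ k * (1 - X) ^ (n + 1 - k)\<close>; it becomes palindromic only together with
  \<open>(X - 1) ^ (n + 1 - k)\<close>, whence the second sum. The constant 1/2 makes the
  Dehn-Sommerville relation homogeneous: since \<open>(-1) ^ n\<close> fixes the Euler
  characteristic, f plus half of it is multiplied by \<open>(-1) ^ (n + 1)\<close> under
  \<open>y\<close> to \<open>-1 - y\<close>. On the topological side only alternating sums of ranks
  matter, so additivity of rank along exact sequences is all the algebra required. One retraction
  serves twice: at a maximal simplex it drives the induction identifying the two Euler
  characteristics, at an arbitrary face it yields the local identity.\<close>

text \<open>The rank of the subgroup \<open>N\<close> is the largest number of steps with non-torsion quotient in an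
  ascending chain of subgroups of \<open>N\<close>; with this definition additivity needs no exchange
  argument.\<close>

definition subgroup_chain :: "('a, 'b) monoid_scheme \<Rightarrow> 'a set \<Rightarrow> (nat \<Rightarrow> 'a set) \<Rightarrow> bool" where
  "subgroup_chain G N H \<longleftrightarrow> (\<forall>i. subgroup (H i) G \<and> H i \<subseteq> H (Suc i) \<and> H i \<subseteq> N)"

definition jumps :: "('a, 'b) monoid_scheme \<Rightarrow> (nat \<Rightarrow> 'a set) \<Rightarrow> nat set" where
  "jumps G H = {i. \<exists>x\<in>H (Suc i). \<forall>k::nat. 0 < k \<longrightarrow> x [^]\<^bsub>G\<^esub> k \<notin> H i}"

definition free_rank :: "('a, 'b) monoid_scheme \<Rightarrow> 'a set \<Rightarrow> enat" where
  "free_rank G N = Sup {enat (card J) | H J. subgroup_chain G N H \<and> finite J \<and> J \<subseteq> jumps G H}"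

lemma free_rank_geI:
  "\<lbrakk>subgroup_chain G N H; finite J; J \<subseteq> jumps G H\<rbrakk> \<Longrightarrow> enat (card J) \<le> free_rank G N"
  unfolding free_rank_def by (rule Sup_upper) auto

lemma free_rank_leI:
  "(\<And>H J. \<lbrakk>subgroup_chain G N H; finite J; J \<subseteq> jumps G H\<rbrakk> \<Longrightarrow> enat (card J) \<le> r) \<Longrightarrow> free_rank G N \<le> r"
  unfolding free_rank_def by (rule Sup_least) auto

lemma subgroup_chain_mono:
  assumes "subgroup_chain G N H" "i \<le> j" shows "H i \<subseteq> H j"
  using lift_Suc_mono_le[of H i j] assms unfolding subgroup_chain_def by blast

lemma (in group) free_rank_one: "free_rank G {\<one>} = 0"
proof -
  have "free_rank G {\<one>} \<le> 0"
  proof (rule free_rank_leI)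
    fix H J assume H: "subgroup_chain G {\<one>} H" and J: "J \<subseteq> jumps G H"
    have "H i = {\<one>}" for i
      using H subgroup.one_closed unfolding subgroup_chain_def by blast
    then have "jumps G H = {}"
      unfolding jumps_def by auto
    with J show "enat (card J) \<le> 0"
      by (simp add: zero_enat_def)
  qed
  then show ?thesis by simp
qed

text \<open>If some multiple of an element \<open>x\<close> witnessing a jump is mapped into the image of the smaller
  subgroup, then that multiple can be corrected into a witness for a jump in the kernel.\<close>

lemma free_rank_hom:
  assumes "comm_group G" "group G'" and h: "h \<in> hom G G'"
  shows "free_rank G (carrier G) = free_rank G (kernel G G' h) + free_rank G' (h ` carrier G)"
proof (rule antisym)
  interpret G: comm_group G by fact
  interpret G': group G' by fact
  interpret h: group_hom G G' h by unfold_locales (rule h)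
  let ?N = "kernel G G' h"
  have hpow: "h (x [^]\<^bsub>G\<^esub> k) = h x [^]\<^bsub>G'\<^esub> k" if "x \<in> carrier G" for x and k :: nat
    using that by (rule h.hom_nat_pow)
  have subN: "subgroup ?N G" by (rule h.subgroup_kernel)
  show "free_rank G (carrier G) \<le> free_rank G ?N + free_rank G' (h ` carrier G)"
  proof (rule free_rank_leI)
    fix H J assume H: "subgroup_chain G (carrier G) H" and fin: "finite J" and J: "J \<subseteq> jumps G H"
    define H1 where "H1 i = H i \<inter> ?N" for i
    define H2 where "H2 i = h ` H i" for i
    have sub: "subgroup (H i) G" for i using H by (auto simp: subgroup_chain_def)
    have HG: "H i \<subseteq> carrier G" for i using sub subgroup.subset by blast
    have powsub: "x [^]\<^bsub>G\<^esub> k \<in> H i" if "x \<in> H i" for x i and k :: nat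
      using that sub[of i] by (induction k) (auto intro: subgroup.m_closed subgroup.one_closed)
    have c1: "subgroup_chain G ?N H1"
      using H subN unfolding subgroup_chain_def H1_def
      by (auto intro: G.subgroups_Inter_pair)
    have c2: "subgroup_chain G' (h ` carrier G) H2"
      using H unfolding subgroup_chain_def H2_def
      by (auto intro: h.subgroup_img_is_subgroup)
    have "i \<in> jumps G H1" if i: "i \<in> jumps G H" "i \<notin> jumps G' H2" for i
    proof -
      obtain x where x: "x \<in> H (Suc i)" "\<And>k::nat. 0 < k \<Longrightarrow> x [^]\<^bsub>G\<^esub> k \<notin> H i"
        using i by (auto simp: jumps_def)
      have xG: "x \<in> carrier G" using x HG by blast
      have "h x \<in> H2 (Suc i)" using x by (auto simp: H2_def)
      then obtain k :: nat where k: "0 < k" "h x [^]\<^bsub>G'\<^esub> k \<in> H2 i"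
        using i by (auto simp: jumps_def)
      then obtain y where y: "y \<in> H i" "h (x [^]\<^bsub>G\<^esub> k) = h y"
        using xG by (auto simp: H2_def hpow)
      have yG: "y \<in> carrier G" using y HG by blast
      let ?z = "x [^]\<^bsub>G\<^esub> k \<otimes>\<^bsub>G\<^esub> inv\<^bsub>G\<^esub> y"
      have "?z \<in> ?N"
        using y xG yG by (simp add: kernel_def)
      moreover have "?z \<in> H (Suc i)"
        using x(1) y(1) H sub[of "Suc i"] powsub
        by (meson subgroup.m_closed subgroup.m_inv_closed subgroup_chain_def subsetD)
      moreover have "?z [^]\<^bsub>G\<^esub> m \<notin> H i" if m: "0 < m" for m :: nat
      proof
        assume *: "?z [^]\<^bsub>G\<^esub> m \<in> H i"
        have "?z [^]\<^bsub>G\<^esub> m \<otimes>\<^bsub>G\<^esub> y [^]\<^bsub>G\<^esub> m = (?z \<otimes>\<^bsub>G\<^esub> y) [^]\<^bsub>G\<^esub> m"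
          using xG yG by (simp add: G.nat_pow_distrib)
        also have "\<dots> = x [^]\<^bsub>G\<^esub> (k * m)"
          using xG yG by (simp add: G.m_assoc G.nat_pow_pow)
        finally have "x [^]\<^bsub>G\<^esub> (k * m) \<in> H i"
          using * y(1) sub[of i] powsub by (metis subgroup.m_closed)
        then show False using x(2)[of "k * m"] k m by simp
      qed
      ultimately show ?thesis
        unfolding jumps_def H1_def by blast
    qed
    then have J1: "J - jumps G' H2 \<subseteq> jumps G H1" using J by auto
    have "enat (card J) = enat (card (J - jumps G' H2)) + enat (card (J \<inter> jumps G' H2))"
      using fin by (metis add.commute card_Int_Diff plus_enat_simps(1))
    also have "\<dots> \<le> free_rank G ?N + free_rank G' (h ` carrier G)"
      by (intro add_mono free_rank_geI[OF c1 _ J1] free_rank_geI[OF c2]) (use fin in auto)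
    finally show "enat (card J) \<le> free_rank G ?N + free_rank G' (h ` carrier G)" .
  qed
  have key: "enat (card J1) + enat (card J2) \<le> free_rank G (carrier G)"
    if H1: "subgroup_chain G ?N H1" and J1: "finite J1" "J1 \<subseteq> jumps G H1"
     and H2: "subgroup_chain G' (h ` carrier G) H2" and J2: "finite J2" "J2 \<subseteq> jumps G' H2"
   for H1 J1 H2 J2
  proof -
    obtain m where m: "\<And>i. i \<in> J1 \<Longrightarrow> i < m"
      using J1(1) by (meson finite_nat_iff_bounded lessThan_iff subsetD)
    \<comment> \<open>The chain in the kernel is cut at \<open>m\<close>, beyond all its counted
      jumps, and continued by preimages of the chain in the image. All preimages contain the kernel,
      so the result is ascending, and jump \<open>i\<close> of \<open>H2\<close> moves to
      \<open>i + Suc m\<close>.\<close>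
    define H where "H i = (if i \<le> m then H1 i else {x \<in> carrier G. h x \<in> H2 (i - Suc m)})" for i
    have s2: "subgroup {x \<in> carrier G. h x \<in> H2 i} G" for i
    proof -
      have s: "subgroup (H2 i) G'" using H2 by (auto simp: subgroup_chain_def)
      show ?thesis
        using s by unfold_locales (auto simp: subgroup.m_closed subgroup.one_closed subgroup.m_inv_closed)
    qed
    have "subgroup_chain G (carrier G) H"
      unfolding subgroup_chain_def
    proof (intro allI conjI)
      fix i
      show "subgroup (H i) G"
        using H1 s2 by (auto simp: H_def subgroup_chain_def)
      then show "H i \<subseteq> carrier G" by (rule subgroup.subset)
      consider "i < m" | "i = m" | "i > m" by linarith
      then show "H i \<subseteq> H (Suc i)"
      proof cases
        case 1 then show ?thesis using H1 by (auto simp: H_def subgroup_chain_def)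
      next
        case 2
        have "\<one>\<^bsub>G'\<^esub> \<in> H2 0" using H2 unfolding subgroup_chain_def by (blast intro: subgroup.one_closed)
        moreover have "H1 m \<subseteq> ?N" using H1 by (auto simp: subgroup_chain_def)
        ultimately show ?thesis using 2 by (auto simp: H_def kernel_def)
      next
        case 3
        then have "Suc i - Suc m = Suc (i - Suc m)" by simp
        then show ?thesis using 3 H2 by (auto simp: H_def subgroup_chain_def)
      qed
    qed
    moreover have "J1 \<union> (\<lambda>i. i + Suc m) ` J2 \<subseteq> jumps G H"
    proof (intro Un_least subsetI)
      fix i assume "i \<in> J1"
      then show "i \<in> jumps G H" using J1(2) m[of i] by (auto simp: jumps_def H_def)
    next
      fix j assume "j \<in> (\<lambda>i. i + Suc m) ` J2"
      then obtain i where i: "j = i + Suc m" "i \<in> jumps G' H2" using J2 by auto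
      then obtain z where z: "z \<in> H2 (Suc i)" "\<And>k::nat. 0 < k \<Longrightarrow> z [^]\<^bsub>G'\<^esub> k \<notin> H2 i"
        by (auto simp: jumps_def)
      have "z \<in> h ` carrier G"
        using z(1) H2 unfolding subgroup_chain_def by blast
      then obtain x where x: "x \<in> carrier G" "h x = z"
        by blast
      have "x \<in> H (Suc j)" using i x z by (auto simp: H_def)
      moreover have "x [^]\<^bsub>G\<^esub> k \<notin> H j" if "0 < k" for k :: nat
        using i x z(2)[OF that] by (auto simp: H_def hpow)
      ultimately show "j \<in> jumps G H" unfolding jumps_def by blast
    qed
    ultimately have "enat (card (J1 \<union> (\<lambda>i. i + Suc m) ` J2)) \<le> free_rank G (carrier G)"
      using J1 J2 by (intro free_rank_geI) auto
    moreover have "card (J1 \<union> (\<lambda>i. i + Suc m) ` J2) = card J1 + card J2"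
    proof -
      have "J1 \<inter> (\<lambda>i. i + Suc m) ` J2 = {}"
        using m by fastforce
      moreover have "inj_on (\<lambda>i. i + Suc m) J2"
        by (simp add: inj_on_def)
      ultimately show ?thesis
        using J1(1) J2(1) by (simp add: card_Un_disjoint card_image)
    qed
    ultimately show ?thesis by simp
  qed
  show "free_rank G ?N + free_rank G' (h ` carrier G) \<le> free_rank G (carrier G)"
  proof (cases "free_rank G (carrier G)")
    case (enat r)
    \<comment> \<open>Pairing a chain with a trivial one shows that neither summand exceeds
      \<open>r\<close>, so the truncated subtractions \<open>r - card J2\<close> and
      \<open>r - a\<close> below are exact.\<close>
    have triv1: "subgroup_chain G ?N (\<lambda>_. {\<one>\<^bsub>G\<^esub>})"
      using G.triv_subgroup subgroup.one_closed[OF subN] by (simp add: subgroup_chain_def)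
    have "h \<one>\<^bsub>G\<^esub> \<in> h ` carrier G"
      by (rule imageI) simp
    then have "\<one>\<^bsub>G'\<^esub> \<in> h ` carrier G"
      by simp
    then have triv2: "subgroup_chain G' (h ` carrier G) (\<lambda>_. {\<one>\<^bsub>G'\<^esub>})"
      using G'.triv_subgroup by (simp add: subgroup_chain_def)
    \<comment> \<open>\<open>key\<close> bounds pairs of chains. The supremum is taken over the
      chains in the kernel with \<open>H2\<close> fixed, and afterwards over those in the
      image.\<close>
    have bound: "free_rank G ?N + enat (card J2) \<le> free_rank G (carrier G)"
      if "subgroup_chain G' (h ` carrier G) H2" "finite J2" "J2 \<subseteq> jumps G' H2" for H2 J2
    proof -
      have "free_rank G ?N \<le> enat (r - card J2)"
      proof (rule free_rank_leI)
        fix H J assume "subgroup_chain G ?N H" "finite J" "J \<subseteq> jumps G H"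
        from key[OF this that] show "enat (card J) \<le> enat (r - card J2)"
          unfolding enat by simp
      qed
      moreover have "card J2 \<le> r"
        using key[OF triv1 _ _ that, of "{}"] enat by simp
      ultimately show ?thesis
        unfolding enat by (cases "free_rank G ?N") auto
    qed
    have "free_rank G ?N + enat (card {}) \<le> free_rank G (carrier G)"
      using bound[OF triv2, of "{}"] by simp
    then obtain a where a: "free_rank G ?N = enat a" "a \<le> r"
      using enat by (cases "free_rank G ?N") auto
    have "free_rank G' (h ` carrier G) \<le> enat (r - a)"
    proof (rule free_rank_leI)
      fix H J assume "subgroup_chain G' (h ` carrier G) H" "finite J" "J \<subseteq> jumps G' H"
      from bound[OF this] show "enat (card J) \<le> enat (r - a)"
        unfolding enat a by simp
    qed
    then have "free_rank G ?N + free_rank G' (h ` carrier G) \<le> enat a + enat (r - a)"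
      unfolding a(1) by (rule add_left_mono)
    also have "\<dots> = enat r" using a(2) by simp
    finally show ?thesis unfolding enat .
  next
    case infinity
    then show ?thesis by simp
  qed
qed

abbreviation grank :: "('a, 'b) monoid_scheme \<Rightarrow> enat" where
  "grank G \<equiv> free_rank G (carrier G)"

lemma grank_iso:
  assumes "G \<cong> G'" "comm_group G" "group G'"
  shows "grank G = grank G'"
proof -
  obtain h where h: "h \<in> iso G G'" using assms by (auto simp: is_iso_def)
  interpret G: comm_group G by fact
  interpret G': group G' by fact
  interpret h: group_hom G G' h using h by unfold_locales (auto simp: iso_def)
  have "kernel G G' h = {\<one>\<^bsub>G\<^esub>}"
    using h h.inj_iff_trivial_ker by (auto simp: iso_def bij_betw_def)
  moreover have "h ` carrier G = carrier G'"
    using h by (auto simp: iso_def bij_betw_def)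
  ultimately show ?thesis
    using free_rank_hom[OF assms(2,3) h.homh] G.free_rank_one by simp
qed

lemma grank_trivial: "trivial_group G \<Longrightarrow> grank G = 0"
  using group.free_rank_one unfolding trivial_group_def by fastforce

text \<open>If \<open>x\<close> witnesses a jump at \<open>i\<close>, then \<open>H i\<close> is
  zero: a nonzero \<open>a\<close> in it would put \<open>\<bar>a\<bar> * x\<close>, a multiple of
  both \<open>a\<close> and \<open>x\<close>, into \<open>H i\<close>. As \<open>H (Suc i)\<close>
  is then nonzero, no later jump is possible.\<close>

lemma grank_integer_group: "grank integer_group = 1"
proof (rule antisym)
  interpret group integer_group by simp
  show "grank integer_group \<le> 1"
  proof (rule free_rank_leI)
    fix H J assume H: "subgroup_chain integer_group (carrier integer_group) H"
      and J: "finite J" "J \<subseteq> jumps integer_group H"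
    have triv: "H i \<subseteq> {0}" "H (Suc i) \<noteq> {0}" if i: "i \<in> jumps integer_group H" for i
    proof -
      obtain x where x: "x \<in> H (Suc i)" "\<And>k::nat. 0 < k \<Longrightarrow> int k * x \<notin> H i"
        using i by (auto simp: jumps_def)
      have sub: "subgroup (H i) integer_group" using H by (auto simp: subgroup_chain_def)
      show "H i \<subseteq> {0}"
      proof
        fix a assume a: "a \<in> H i"
        have "a \<noteq> 0 \<Longrightarrow> False"
        proof -
          assume "a \<noteq> 0"
          have "a [^]\<^bsub>integer_group\<^esub> (x * sgn a) \<in> H i"
            using a sub by (metis subgroup.subset subgroup_int_pow_closed)
          then have "(x * sgn a) * a \<in> H i" by (simp add: mult.commute)
          moreover have "(x * sgn a) * a = int (nat \<bar>a\<bar>) * x" by (cases "a \<ge> 0") (auto simp: sgn_if)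
          ultimately show False using x(2)[of "nat \<bar>a\<bar>"] \<open>a \<noteq> 0\<close> by simp
        qed
        then show "a \<in> {0}" by auto
      qed
      have "0 \<in> H i" using subgroup.one_closed[OF sub] by simp
      then have "x \<noteq> 0" using x(2)[of 1] by auto
      then show "H (Suc i) \<noteq> {0}" using x(1) by blast
    qed
    have "i = j" if "i \<in> J" "j \<in> J" for i j
    proof -
      have "\<not> i < j" if "i \<in> J" "j \<in> J" for i j
      proof
        assume "i < j"
        then have "H (Suc i) \<subseteq> H j" using subgroup_chain_mono[OF H] by simp
        moreover have "0 \<in> H (Suc i)"
          using H subgroup.one_closed[of "H (Suc i)" integer_group] by (simp add: subgroup_chain_def)
        ultimately show False using triv(1)[of j] triv(2)[of i] that J by blast
      qed
      then show ?thesis using that by (metis linorder_neqE_nat)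
    qed
    then have "card J \<le> 1" using J(1) by (simp add: card_le_Suc0_iff_eq)
    then show "enat (card J) \<le> 1" by (simp add: one_enat_def)
  qed
  have "subgroup_chain integer_group (carrier integer_group) (\<lambda>i. if i = 0 then {0} else UNIV)"
    using triv_subgroup subgroup_self by (simp add: subgroup_chain_def)
  moreover have "{0} \<subseteq> jumps integer_group (\<lambda>i. if i = 0 then {0} else UNIV)"
    by (auto simp: jumps_def intro: exI[of _ 1])
  ultimately have "enat (card {0::nat}) \<le> grank integer_group"
    by (intro free_rank_geI) auto
  then show "1 \<le> grank integer_group" by (simp add: one_enat_def)
qed

subsection \<open>Homological Euler characteristic\<close>

text \<open>Here \<open>r\<close> stands for the sequence of Betti numbers. Finiteness and vanishing
  outside a bounded range of degrees are part of the relation, so each instance also asserts that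
  the alternating sum makes sense.\<close>

definition has_chi :: "(int \<Rightarrow> enat) \<Rightarrow> int \<Rightarrow> bool" where
  "has_chi r e \<longleftrightarrow> (\<forall>p. r p \<noteq> \<infinity>) \<and>
     (\<exists>N. (\<forall>p. p < 0 \<or> int N \<le> p \<longrightarrow> r p = 0) \<and> e = (\<Sum>i<N. (-1) ^ i * int (the_enat (r (int i)))))"

lemma has_chi_bound:
  assumes "has_chi r e"
  obtains N where "\<And>M. N \<le> M \<Longrightarrow> e = (\<Sum>i<M. (-1) ^ i * int (the_enat (r (int i))))"
    and "\<And>p. p < 0 \<or> int N \<le> p \<Longrightarrow> r p = 0" and "\<And>p. r p \<noteq> \<infinity>"
proof -
  obtain N where N: "\<And>p. p < 0 \<or> int N \<le> p \<Longrightarrow> r p = 0"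
    "e = (\<Sum>i<N. (-1) ^ i * int (the_enat (r (int i))))"
    using assms by (auto simp: has_chi_def)
  have "e = (\<Sum>i<M. (-1) ^ i * int (the_enat (r (int i))))" if "N \<le> M" for M
    unfolding N(2) using that N(1)
    by (intro sum.mono_neutral_left) (auto simp: zero_enat_def)
  with N(1) assms that show thesis by (auto simp: has_chi_def)
qed

lemma has_chi_unique:
  assumes "has_chi r e" "has_chi r e'" shows "e = e'"
proof -
  obtain N where N: "\<And>M. N \<le> M \<Longrightarrow> e = (\<Sum>i<M. (-1) ^ i * int (the_enat (r (int i))))"
    using has_chi_bound[OF assms(1)] by metis
  obtain N' where N': "\<And>M. N' \<le> M \<Longrightarrow> e' = (\<Sum>i<M. (-1) ^ i * int (the_enat (r (int i))))"
    using has_chi_bound[OF assms(2)] by metis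
  show ?thesis using N[of "max N N'"] N'[of "max N N'"] by simp
qed

text \<open>Rank form of a long exact sequence: \<open>a\<close>, \<open>b\<close>, \<open>c\<close>
  are the ranks of the images of its three kinds of maps, with \<open>a p\<close> belonging to the
  boundary map from degree \<open>p\<close> to \<open>p - 1\<close>. Each \<open>a p\<close> enters
  \<open>x\<close> and \<open>z\<close> with opposite signs.\<close>

lemma has_chi_exact:
  fixes a b c :: "int \<Rightarrow> enat"
  assumes A: "has_chi r x" "\<And>p. r p = a (p + 1) + b p"
    and C: "has_chi t z" "\<And>p. t p = c p + a p"
    and B: "\<And>p. s p = b p + c p"
  shows "has_chi s (x + z)"
proof -
  obtain N1 where N1': "\<And>M. N1 \<le> M \<Longrightarrow> x = (\<Sum>i<M. (-1) ^ i * int (the_enat (r (int i))))"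
    and z1': "\<And>p. p < 0 \<or> int N1 \<le> p \<Longrightarrow> r p = 0" and f1': "\<And>p. r p \<noteq> \<infinity>"
    by (rule has_chi_bound[OF A(1)]) blast
  obtain N2 where N2': "\<And>M. N2 \<le> M \<Longrightarrow> z = (\<Sum>i<M. (-1) ^ i * int (the_enat (t (int i))))"
    and z2': "\<And>p. p < 0 \<or> int N2 \<le> p \<Longrightarrow> t p = 0" and f2': "\<And>p. t p \<noteq> \<infinity>"
    by (rule has_chi_bound[OF C(1)]) blast
  note N1 = N1'[unfolded A(2)] and z1 = z1'[unfolded A(2)] and f1 = f1'[unfolded A(2)]
  note N2 = N2'[unfolded C(2)] and z2 = z2'[unfolded C(2)] and f2 = f2'[unfolded C(2)]
  define N where "N = max N1 N2"
  define a' b' c' where "a' p = int (the_enat (a p))" and "b' p = int (the_enat (b p))"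
    and "c' p = int (the_enat (c p))" for p
  have fin: "a p \<noteq> \<infinity>" "b p \<noteq> \<infinity>" "c p \<noteq> \<infinity>" for p
    using f1[of p] f2[of p] by (simp_all only: plus_eq_infty_iff_enat de_Morgan_disj not_False_eq_True)
  have the_add: "int (the_enat (u + v)) = int (the_enat u) + int (the_enat v)"
    if "u \<noteq> \<infinity>" "v \<noteq> \<infinity>" for u v
    using that by (cases u; cases v) simp_all
  have x: "x = (\<Sum>i<N. (-1) ^ i * (a' (int i + 1) + b' (int i)))"
    using N1[of N] by (simp add: N_def the_add fin a'_def b'_def)
  have z: "z = (\<Sum>i<N. (-1) ^ i * (c' (int i) + a' (int i)))"
    using N2[of N] by (simp add: N_def the_add fin a'_def c'_def)
  \<comment> \<open>The ends of the telescoping sum vanish: \<open>a 0\<close> is a summand of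
    \<open>r (-1)\<close>, and \<open>a (int N)\<close> one of \<open>t (int N)\<close>.\<close>
  have "a 0 = 0" using z1[of "-1"] by simp
  then have a0: "a' 0 = 0" by (simp add: a'_def zero_enat_def)
  have "a (int N) = 0" using z2[of "int N"] by (simp add: N_def)
  then have aN: "a' (int N) = 0" by (simp add: a'_def zero_enat_def)
  have tele: "(\<Sum>i<M. (-1) ^ i * (a' (int i + 1) + a' (int i))) = a' 0 - (-1) ^ M * a' (int M)" for M
    by (induction M) (auto simp: algebra_simps)
  have "x + z = (\<Sum>i<N. (-1) ^ i * (b' (int i) + c' (int i))) +
      (\<Sum>i<N. (-1) ^ i * (a' (int i + 1) + a' (int i)))"
    unfolding x z by (simp add: algebra_simps sum.distrib)
  then have eq: "x + z = (\<Sum>i<N. (-1) ^ i * int (the_enat (b (int i) + c (int i))))"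
    unfolding tele a0 aN by (simp add: the_add fin b'_def c'_def)
  show ?thesis
    unfolding has_chi_def B
  proof (intro conjI allI exI[of _ N] impI)
    fix p assume "p < 0 \<or> int N \<le> p"
    then show "b p + c p = 0"
      using z1[of p] z2[of p] by (auto simp: N_def)
  next
    fix p show "b p + c p \<noteq> \<infinity>" using fin[of p] by (simp add: plus_eq_infty_iff_enat del: not_infinity_eq)
  qed (rule eq)
qed

definition space_chi :: "'a topology \<Rightarrow> 'a set \<Rightarrow> int \<Rightarrow> bool" where
  "space_chi X S = has_chi (\<lambda>p. grank (relative_homology_group p X S))"

lemma space_chi_unique: "space_chi X S e \<Longrightarrow> space_chi X S e' \<Longrightarrow> e = e'"
  unfolding space_chi_def by (rule has_chi_unique)

lemma space_chi_iso:
  assumes "\<And>p. relative_homology_group p X S \<cong> relative_homology_group p Y T"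
  shows "space_chi X S e \<longleftrightarrow> space_chi Y T e"
  unfolding space_chi_def using grank_iso[OF assms] by simp

text \<open>Exactness identifies the kernel of each map in the sequence of the pair with the image
  of the preceding one, so \<open>free_rank_hom\<close> splits each of the three ranks into two
  image ranks.\<close>

lemma space_chi_pair:
  assumes A: "space_chi (subtopology X S) {} x" and C: "space_chi X S z"
  shows "space_chi X {} (x + z)"
proof -
  define a where "a p = free_rank (homology_group (p - 1) (subtopology X S))
    (hom_boundary p X S ` carrier (relative_homology_group p X S))" for p
  define b where "b p = free_rank (homology_group p X)
    (hom_induced p (subtopology X S) {} X {} id ` carrier (homology_group p (subtopology X S)))" for p
  define c where "c p = free_rank (relative_homology_group p X S)
    (hom_induced p X {} X S id ` carrier (homology_group p X))" for p
  have rA: "grank (homology_group p (subtopology X S)) = a (p + 1) + b p" for p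
    using free_rank_hom[of "homology_group p (subtopology X S)" "homology_group p X"
        "hom_induced p (subtopology X S) {} X {} id"] homology_exactness_axiom_2[of "p + 1" X S]
    by (simp add: hom_induced_hom a_def b_def)
  have rB: "grank (homology_group p X) = b p + c p" for p
    using free_rank_hom[of "homology_group p X" "relative_homology_group p X S"
        "hom_induced p X {} X S id"] homology_exactness_axiom_3[of p X S]
    by (simp add: hom_induced_hom c_def b_def)
  have rC: "grank (relative_homology_group p X S) = c p + a p" for p
    using free_rank_hom[of "relative_homology_group p X S" "homology_group (p - 1) (subtopology X S)"
        "hom_boundary p X S"] homology_exactness_axiom_1[of p X S]
    by (simp add: hom_boundary_hom c_def a_def)
  show ?thesis
    unfolding space_chi_def
    by (rule has_chi_exact[of _ x a b _ z c, OF A[unfolded space_chi_def] rA C[unfolded space_chi_def] rC rB])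
qed

text \<open>Degree and dimension can be lowered together, which leads to the homology of the
  one-point space \<open>Euclidean_space 0\<close> in degree \<open>p - int n\<close>.\<close>

lemma grank_Euclidean:
  "grank (relative_homology_group p (Euclidean_space n) (topspace (Euclidean_space n) - {\<lambda>i. 0}))
     = (if p = int n then 1 else 0)"
proof -
  have E0: "topspace (Euclidean_space 0) = {\<lambda>i. 0}"
    by (auto simp: topspace_Euclidean_space)
  have "closedin (Euclidean_space 0) {\<lambda>i. 0}"
    using closedin_topspace[of "Euclidean_space 0"] by (simp add: E0)
  from relative_homology_group_Euclidean_complement_step[OF this, of "p - int n" n]
  have "homology_group (p - int n) (Euclidean_space 0) \<cong>
      relative_homology_group p (Euclidean_space n) (topspace (Euclidean_space n) - {\<lambda>i. 0})"
    by (simp add: E0)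
  then have "grank (relative_homology_group p (Euclidean_space n) (topspace (Euclidean_space n) - {\<lambda>i. 0}))
    = grank (homology_group (p - int n) (Euclidean_space 0))"
    using grank_iso by fastforce
  also have "\<dots> = (if p = int n then 1 else 0)"
  proof (cases "p = int n")
    case True
    then show ?thesis
      using grank_iso[OF homology_coefficients[OF E0]] using grank_integer_group by simp
  next
    case False
    then show ?thesis
      using homology_dimension_axiom[OF E0] by (simp add: grank_trivial)
  qed
  finally show ?thesis .
qed

lemma space_chi_Euclidean:
  "space_chi (Euclidean_space n) (topspace (Euclidean_space n) - {\<lambda>i. 0}) ((-1) ^ n)"
  unfolding space_chi_def grank_Euclidean has_chi_def
proof (intro conjI allI exI[of _ "Suc n"])
  show "(-1) ^ n = (\<Sum>i<Suc n. (-1) ^ i * int (the_enat (if int i = int n then 1 else 0)))"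
    by (subst sum.mono_neutral_right[of _ "{n}"]) (auto simp: zero_enat_def one_enat_def)
qed (auto simp: zero_enat_def one_enat_def)

lemma space_chi_empty: "space_chi (top_of_set {}) {} 0"
  unfolding space_chi_def has_chi_def
  using grank_trivial[OF trivial_homology_group_empty[of "top_of_set {}"]]
  by (auto simp: zero_enat_def intro!: exI[of _ 0])

subsection \<open>Barycentric coordinates on simplicial complexes\<close>

definition verts :: "'a::euclidean_space set \<Rightarrow> 'a set" where
  "verts S = {v. v extreme_point_of S}"

lemma verts_convex_hull: "\<not> affine_dependent U \<Longrightarrow> verts (convex hull U) = U"
  by (simp add: verts_def extreme_point_of_convex_hull_affine_independent)

lemma simplex_verts:
  assumes "n simplex S"
  shows "\<not> affine_dependent (verts S)" "convex hull (verts S) = S" "int (card (verts S)) = n + 1"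
    "finite (verts S)"
proof -
  obtain C where "\<not> affine_dependent C" "int (card C) = n + 1" "S = convex hull C"
    using assms by (auto simp: simplex_def)
  then show "\<not> affine_dependent (verts S)" "convex hull (verts S) = S" "int (card (verts S)) = n + 1"
    "finite (verts S)"
    by (simp_all add: verts_convex_hull aff_independent_finite)
qed

lemma simplex_face_iff:
  assumes "n simplex S"
  shows "F face_of S \<longleftrightarrow> (\<exists>U\<subseteq>verts S. F = convex hull U)"
  using face_of_convex_hull_affine_independent[OF simplex_verts(1)[OF assms]] simplex_verts(2)[OF assms]
  by simp

lemma simplex_verts_face:
  assumes "n simplex S" "U \<subseteq> verts S"
  shows "verts (convex hull U) = U"
  using assms simplex_verts(1) affine_dependent_subset verts_convex_hull by blast

text \<open>For affinely independent \<open>V\<close> this is an affine functional equal to 1 at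
  \<open>w\<close> and 0 at the other vertices. It lives on the whole space, so continuity follows
  from linearity; off the affine hull its values depend on the choice and are irrelevant.\<close>

definition bary :: "'a::euclidean_space set \<Rightarrow> 'a \<Rightarrow> 'a \<Rightarrow> real" where
  "bary V w y =
     (if w \<in> V then 1 + (SOME f. linear f \<and> (\<forall>v\<in>V - {w}. f (v - w) = -1)) (y - w) else 0)"

lemma bary_functional:
  assumes "\<not> affine_dependent V" "w \<in> V"
  obtains f where "linear f" "\<And>v. v \<in> V - {w} \<Longrightarrow> f (v - w) = -1" "bary V w = (\<lambda>y. 1 + f (y - w))"
proof -
  have "independent ((\<lambda>v. - w + v) ` (V - {w}))"
    using affine_dependent_iff_dependent2[OF assms(2)] assms(1) by simp
  then obtain g :: "'a \<Rightarrow> real" where g: "linear g" "\<And>z. z \<in> (\<lambda>v. - w + v) ` (V - {w}) \<Longrightarrow> g z = -1"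
    using linear_independent_extend[of _ "\<lambda>_. -1"] by blast
  have "\<exists>f. linear f \<and> (\<forall>v\<in>V - {w}. f (v - w) = (-1::real))"
    using g by (intro exI[of _ g]) auto
  from someI_ex[OF this] show thesis
    by (intro that[of "SOME f. linear f \<and> (\<forall>v\<in>V - {w}. f (v - w) = -1)"])
      (auto simp: bary_def assms(2))
qed

lemma bary_sum:
  assumes V: "\<not> affine_dependent V" and w: "w \<in> V" and u: "sum u V = 1"
  shows "bary V w (\<Sum>v\<in>V. u v *\<^sub>R v) = u w"
proof -
  obtain f where f: "linear f" "\<And>v. v \<in> V - {w} \<Longrightarrow> f (v - w) = -1"
    and b: "bary V w = (\<lambda>y. 1 + f (y - w))"
    using bary_functional[OF V w] by blast
  have fin: "finite V" using V by (rule aff_independent_finite)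
  have "(\<Sum>v\<in>V. u v *\<^sub>R v) - w = (\<Sum>v\<in>V. u v *\<^sub>R (v - w))"
    using u by (simp add: scaleR_diff_right sum_subtractf flip: scaleR_left.sum)
  then have "f ((\<Sum>v\<in>V. u v *\<^sub>R v) - w) = (\<Sum>v\<in>V. u v * f (v - w))"
    using f(1) by (simp add: linear_sum linear_cmul)
  also have "\<dots> = (\<Sum>v\<in>V - {w}. u v * f (v - w))"
    using fin w linear_0[OF f(1)] by (subst sum.remove[of V w]) auto
  also have "\<dots> = - sum u (V - {w})"
    by (simp add: f(2) sum_negf)
  also have "\<dots> = u w - 1"
    using u fin w by (simp add: sum_diff1)
  finally show ?thesis by (simp add: b)
qed

lemma continuous_on_bary:
  assumes "\<not> affine_dependent V"
  shows "continuous_on A (bary V w)"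
proof (cases "w \<in> V")
  case True
  obtain f where f: "linear f" and b: "bary V w = (\<lambda>y. 1 + f (y - w))"
    using bary_functional[OF assms True] by blast
  show ?thesis unfolding b
    by (intro continuous_intros linear_continuous_on_compose[OF _ f])
qed (simp add: bary_def[abs_def])

locale simplicial =
  fixes K :: "'a::euclidean_space set set"
  assumes K: "simplicial_complex K"
begin

lemma finite_K: "finite K"
  using K by (simp add: simplicial_complex_def)

lemma simplex_K:
  assumes "S \<in> K" obtains n where "n simplex S"
  using K assms by (auto simp: simplicial_complex_def)

lemma face_K: "S \<in> K \<Longrightarrow> F face_of S \<Longrightarrow> F \<in> K"
  using K by (auto simp: simplicial_complex_def)

lemma inter_K: "S \<in> K \<Longrightarrow> S' \<in> K \<Longrightarrow> S \<inter> S' face_of S"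
  using K by (auto simp: simplicial_complex_def)

lemma verts_indep: "S \<in> K \<Longrightarrow> \<not> affine_dependent (verts S)"
  by (metis simplex_K simplex_verts(1))

lemma hull_verts: "S \<in> K \<Longrightarrow> convex hull (verts S) = S"
  by (metis simplex_K simplex_verts(2))

lemma finite_verts: "S \<in> K \<Longrightarrow> finite (verts S)"
  by (metis simplex_K simplex_verts(4))

lemma card_verts: "S \<in> K \<Longrightarrow> int (card (verts S)) = aff_dim S + 1"
  by (metis simplex_K simplex_verts(3) aff_dim_simplex)

lemma closed_K: "S \<in> K \<Longrightarrow> closed S"
  by (metis simplex_K closed_simplex)

lemma convex_K: "S \<in> K \<Longrightarrow> convex S"
  by (metis simplex_K convex_simplex)

lemma face_iff: "S \<in> K \<Longrightarrow> F face_of S \<longleftrightarrow> (\<exists>U\<subseteq>verts S. F = convex hull U)"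
  by (metis simplex_K simplex_face_iff)

lemma hull_subset_K: "S \<in> K \<Longrightarrow> U \<subseteq> verts S \<Longrightarrow> convex hull U \<in> K \<and> verts (convex hull U) = U"
  by (metis face_iff face_K simplex_K simplex_verts_face)

lemma subset_face: "F \<in> K \<Longrightarrow> S \<in> K \<Longrightarrow> F \<subseteq> S \<Longrightarrow> F face_of S"
  by (metis inf.absorb_iff2 inter_K)

lemma subset_iff_verts:
  assumes "F \<in> K" "S \<in> K" shows "F \<subseteq> S \<longleftrightarrow> verts F \<subseteq> verts S"
proof
  assume "F \<subseteq> S"
  then obtain U where "U \<subseteq> verts S" "F = convex hull U"
    using subset_face[OF assms] face_iff[OF assms(2), of F] by auto
  then show "verts F \<subseteq> verts S"
    using hull_subset_K[OF assms(2)] by simp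
next
  assume "verts F \<subseteq> verts S"
  then show "F \<subseteq> S" using hull_verts assms hull_mono by metis
qed

lemma simplicial_sub:
  assumes "L \<subseteq> K" "\<And>S F. S \<in> L \<Longrightarrow> F face_of S \<Longrightarrow> F \<in> L"
  shows "simplicial_complex L"
  using K assms unfolding simplicial_complex_def by (meson finite_subset subset_iff)

lemma verts_inter:
  assumes "S \<in> K" "S' \<in> K"
  shows "verts (S \<inter> S') \<subseteq> verts S" "S \<inter> S' \<in> K"
proof -
  show *: "S \<inter> S' \<in> K" using face_K[OF assms(1) inter_K[OF assms]] .
  show "verts (S \<inter> S') \<subseteq> verts S" using subset_iff_verts[OF * assms(1)] by simp
qed

lemma bary_hull:
  assumes S: "S \<in> K" and U: "U \<subseteq> verts S" and u: "sum u U = 1"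
  shows "bary (verts S) w (\<Sum>v\<in>U. u v *\<^sub>R v) = (if w \<in> U then u w else 0)"
proof -
  let ?u = "\<lambda>v. if v \<in> U then u v else 0"
  have fin: "finite (verts S)" using S finite_verts by blast
  have "(\<Sum>v\<in>U. u v *\<^sub>R v) = (\<Sum>v\<in>verts S. ?u v *\<^sub>R v)"
    using U fin by (intro sum.mono_neutral_cong_left) auto
  moreover have "sum ?u (verts S) = 1"
    unfolding u[symmetric] using U fin by (intro sum.mono_neutral_cong_right) auto
  ultimately show ?thesis
    using bary_sum[OF verts_indep[OF S], of w ?u] U
    by (cases "w \<in> verts S") (auto simp: bary_def)
qed

lemma hull_explicit:
  assumes "S \<in> K" "y \<in> S"
  obtains u where "\<And>v. v \<in> verts S \<Longrightarrow> 0 \<le> u v" "sum u (verts S) = 1" "y = (\<Sum>v\<in>verts S. u v *\<^sub>R v)"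
proof -
  have "y \<in> convex hull (verts S)" using assms hull_verts by simp
  then show thesis
    using that unfolding convex_hull_finite[OF finite_verts[OF assms(1)]] by auto
qed

definition coord :: "'a \<Rightarrow> 'a \<Rightarrow> real" where
  "coord w y = bary (verts (SOME S. S \<in> K \<and> y \<in> S)) w y"

text \<open>Any two simplices containing \<open>y\<close> meet in a common face containing
  \<open>y\<close>. Both compute the coordinates from a convex combination of the vertices of that
  face, so the simplex chosen in \<open>coord\<close> does not matter.\<close>

lemma coord_bary:
  assumes S: "S \<in> K" "y \<in> S" shows "coord w y = bary (verts S) w y"
proof -
  define S' where "S' = (SOME S. S \<in> K \<and> y \<in> S)"
  have S': "S' \<in> K" "y \<in> S'"
    using someI[of "\<lambda>S. S \<in> K \<and> y \<in> S"] S unfolding S'_def by blast+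
  have I: "S \<inter> S' \<in> K" "verts (S \<inter> S') \<subseteq> verts S" "verts (S \<inter> S') \<subseteq> verts S'"
    using verts_inter[OF S(1) S'(1)] verts_inter[OF S'(1) S(1)] by (simp_all add: inf_commute)
  obtain u where "sum u (verts (S \<inter> S')) = 1" "y = (\<Sum>v\<in>verts (S \<inter> S'). u v *\<^sub>R v)"
    using hull_explicit[OF I(1)] S S' by (metis IntI)
  then show ?thesis
    using bary_hull[OF S(1) I(2)] bary_hull[OF S'(1) I(3)]
    unfolding coord_def S'_def[symmetric] by simp
qed

lemma coord_sum:
  assumes S: "S \<in> K" and u: "\<And>v. v \<in> verts S \<Longrightarrow> 0 \<le> u v" "sum u (verts S) = 1"
  shows "(\<Sum>v\<in>verts S. u v *\<^sub>R v) \<in> S"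
    and "coord w (\<Sum>v\<in>verts S. u v *\<^sub>R v) = (if w \<in> verts S then u w else 0)"
proof -
  have "(\<Sum>v\<in>verts S. u v *\<^sub>R v) \<in> convex hull (verts S)"
    using u unfolding convex_hull_finite[OF finite_verts[OF S]] by auto
  then show *: "(\<Sum>v\<in>verts S. u v *\<^sub>R v) \<in> S"
    using hull_verts[OF S] by simp
  show "coord w (\<Sum>v\<in>verts S. u v *\<^sub>R v) = (if w \<in> verts S then u w else 0)"
    unfolding coord_bary[OF S *] by (rule bary_hull[OF S order_refl u(2)])
qed

lemma coord_props:
  assumes S: "S \<in> K" "y \<in> S"
  shows "0 \<le> coord w y" "w \<notin> verts S \<Longrightarrow> coord w y = 0"
    "(\<Sum>v\<in>verts S. coord v y) = 1" "(\<Sum>v\<in>verts S. coord v y *\<^sub>R v) = y"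
proof -
  obtain u where u: "\<And>v. v \<in> verts S \<Longrightarrow> 0 \<le> u v" "sum u (verts S) = 1" "y = (\<Sum>v\<in>verts S. u v *\<^sub>R v)"
    using hull_explicit[OF S] by blast
  have c: "coord w y = (if w \<in> verts S then u w else 0)" for w
    unfolding u(3) by (rule coord_sum(2)[OF S(1) u(1,2)])
  show "0 \<le> coord w y" "w \<notin> verts S \<Longrightarrow> coord w y = 0"
    using c u(1) by auto
  show "(\<Sum>v\<in>verts S. coord v y) = 1" "(\<Sum>v\<in>verts S. coord v y *\<^sub>R v) = y"
    using c u(2,3) by auto
qed

lemma continuous_coord: "continuous_on (\<Union>K) (coord w)"
proof -
  have "continuous_on (\<Union>S\<in>K. S) (coord w)"
  proof (rule continuous_on_closed_Union[OF finite_K closed_K])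
    fix S assume S: "S \<in> K"
    show "continuous_on S (coord w)"
      using continuous_on_bary[OF verts_indep[OF S], of S w]
      by (rule continuous_on_eq) (simp add: coord_bary[OF S])
  qed
  then show ?thesis by simp
qed

lemma coord_rel_interior:
  assumes F: "F \<in> K" "x \<in> rel_interior F" and w: "w \<in> verts F"
  shows "0 < coord w x"
proof -
  obtain u where u: "\<And>v. v \<in> verts F \<Longrightarrow> 0 < u v" "sum u (verts F) = 1" "x = (\<Sum>v\<in>verts F. u v *\<^sub>R v)"
    using F(2) rel_interior_convex_hull_explicit[OF verts_indep[OF F(1)]] hull_verts[OF F(1)]
    by simp metis
  have "coord w x = u w"
    unfolding u(3) using coord_sum(2)[OF F(1) _ u(2)] u(1) w by (simp add: less_imp_le)
  then show ?thesis using u(1)[OF w] by simp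
qed

text \<open>The carrier of \<open>y\<close> is spanned by the vertices at which \<open>y\<close> has
  a positive coordinate.\<close>

lemma rel_interior_cover:
  assumes S: "S \<in> K" "y \<in> S"
  obtains F where "F \<in> K" "F face_of S" "y \<in> rel_interior F"
proof -
  let ?U = "{w \<in> verts S. 0 < coord w y}"
  have U: "convex hull ?U \<in> K" "verts (convex hull ?U) = ?U"
    using hull_subset_K[OF S(1), of ?U] by auto
  have nz: "coord v y = 0" if "v \<in> verts S - ?U" for v
  proof -
    have "\<not> 0 < coord v y" using that by blast
    then show ?thesis using coord_props(1)[OF S, of v] by linarith
  qed
  have "(\<Sum>v\<in>?U. coord v y) = (\<Sum>v\<in>verts S. coord v y)"
    "(\<Sum>v\<in>?U. coord v y *\<^sub>R v) = (\<Sum>v\<in>verts S. coord v y *\<^sub>R v)"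
    by (rule sum.mono_neutral_left; use nz finite_verts[OF S(1)] in simp)+
  then have "(\<Sum>v\<in>?U. coord v y) = 1" "(\<Sum>v\<in>?U. coord v y *\<^sub>R v) = y"
    unfolding coord_props(3,4)[OF S] .
  then have "y \<in> rel_interior (convex hull ?U)"
    using verts_indep[OF U(1)] unfolding U(2)
    by (subst rel_interior_convex_hull_explicit) auto
  moreover have "convex hull ?U face_of S" unfolding face_iff[OF S(1)] by (intro exI[of _ ?U]) simp
  ultimately show thesis using that U(1) by blast
qed

text \<open>\<open>F \<inter> S\<close> is a face of \<open>F\<close> that meets the relative
  interior of \<open>F\<close>, hence all of \<open>F\<close>. This turns questions about points
  into questions about vertex sets.\<close>

lemma subset_of_rel_interior:
  assumes "F \<in> K" "S \<in> K" "x \<in> rel_interior F" "x \<in> S"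
  shows "F \<subseteq> S"
proof -
  have "x \<in> F \<inter> S" using assms(3,4) rel_interior_subset by blast
  then show ?thesis
    using subset_of_face_of[OF inter_K[OF assms(1,2)] order_refl] assms(3) by blast
qed

end

lemma continuous_on_Min:
  fixes f :: "'b \<Rightarrow> 'a::topological_space \<Rightarrow> real"
  assumes "finite A" "A \<noteq> {}" "\<And>a. a \<in> A \<Longrightarrow> continuous_on S (f a)"
  shows "continuous_on S (\<lambda>y. Min ((\<lambda>a. f a y) ` A))"
  using assms
proof (induction A rule: finite_ne_induct)
  case (insert a A)
  then have "continuous_on S (\<lambda>y. min (f a y) (Min ((\<lambda>a. f a y) ` A)))"
    by (intro continuous_on_min) auto
  with insert.hyps show ?case by simp
qed simp

section \<open>The radial retraction of a punctured complex\<close>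

context simplicial
begin

text \<open>The retraction moves a point radially away from \<open>x\<close> until one of the barycentric coordinates
  with respect to the vertices of \<open>F\<close> vanishes; \<open>t y\<close> is the multiple of \<open>x\<close> that has
  to be subtracted from \<open>y\<close>.\<close>

lemma punctured_homology:
  assumes F: "F \<in> K" and x: "x \<in> rel_interior F"
  shows "homology_group p (top_of_set (\<Union>K - {x})) \<cong> homology_group p (top_of_set (\<Union>{S \<in> K. \<not> F \<subseteq> S}))"
proof -
  let ?M = "\<Union>K - {x}" and ?L = "\<Union>{S \<in> K. \<not> F \<subseteq> S}"
  define t where "t y = Min ((\<lambda>w. coord w y / coord w x) ` verts F)" for y
  \<comment> \<open>After the subtraction the coordinates add up to \<open>1 - t y\<close>; the
    scalar factor restores total 1.\<close>
  define r where "r y = (1 / (1 - t y)) *\<^sub>R (y - t y *\<^sub>R x)" for y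
  have xF: "x \<in> F" using x rel_interior_subset by blast
  have fin: "finite (verts F)" and ne: "verts F \<noteq> {}"
    using F xF finite_verts hull_verts[OF F] by auto
  have pos: "0 < coord w x" if "w \<in> verts F" for w
    using coord_rel_interior[OF F x that] .
  have t_le: "t y * coord w x \<le> coord w y" if "w \<in> verts F" for w y
  proof -
    have "t y \<le> coord w y / coord w x"
      unfolding t_def using fin that by (intro Min_le) auto
    then show ?thesis using pos[OF that] by (simp add: pos_le_divide_eq)
  qed
  have t_att: "\<exists>w\<in>verts F. t y * coord w x = coord w y" for y
  proof -
    have "t y \<in> (\<lambda>w. coord w y / coord w x) ` verts F"
      unfolding t_def using fin ne by (intro Min_in) auto
    then obtain w where w: "w \<in> verts F" "t y = coord w y / coord w x" by blast
    then show ?thesis using pos[OF w(1)] by (intro bexI[of _ w]) auto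
  qed
  have t_nonneg: "0 \<le> t y" if S: "S \<in> K" "y \<in> S" for S y
  proof -
    obtain w where "w \<in> verts F" "t y * coord w x = coord w y" using t_att by blast
    then show ?thesis
      using pos[of w] coord_props(1)[OF S, of w] by (metis mult_neg_pos not_le)
  qed
  \<comment> \<open>A simplex not containing \<open>F\<close> lacks some vertex of \<open>F\<close>,
    where \<open>y\<close> has coordinate 0. The minimum is therefore 0 and \<open>r\<close> fixes
    \<open>y\<close>.\<close>
  have t0: "t y = 0" if S: "S \<in> K" "y \<in> S" "\<not> F \<subseteq> S" for S y
  proof -
    obtain w where w: "w \<in> verts F" "w \<notin> verts S"
      using S subset_iff_verts[OF F S(1)] by blast
    then have "t y * coord w x \<le> 0"
      using t_le[OF w(1), of y] coord_props(2)[OF S(1,2) w(2)] by simp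
    then show ?thesis
      using pos[OF w(1)] t_nonneg[OF S(1,2)] by (simp add: mult_le_0_iff)
  qed
  have coord_x0: "coord w x = 0" if "w \<notin> verts F" for w
    using coord_props(2)[OF F xF that] .
  \<comment> \<open>If \<open>t y\<close> were 1, the nonnegative differences of the coordinates of
    \<open>y\<close> and \<open>x\<close> would add up to 0, forcing \<open>y = x\<close>. This is
    what makes the denominator of \<open>r\<close> positive.\<close>
  have t1: "t y < 1" if S: "S \<in> K" "y \<in> S" "F \<subseteq> S" "y \<noteq> x" for S y
  proof -
    have sub: "verts F \<subseteq> verts S" using S subset_iff_verts[OF F S(1)] by blast
    have xS: "x \<in> S" using S xF by blast
    have nn: "0 \<le> coord w y - t y * coord w x" for w
      using t_le[of w y] coord_x0[of w] coord_props(1)[OF S(1,2), of w] by (cases "w \<in> verts F") auto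
    have sum: "(\<Sum>w\<in>verts S. coord w y - t y * coord w x) = 1 - t y"
      using coord_props(3)[OF S(1,2)] coord_props(3)[OF S(1) xS]
      by (simp add: sum_subtractf flip: sum_distrib_left)
    have "t y \<noteq> 1"
    proof
      assume "t y = 1"
      then have "(\<Sum>w\<in>verts S. coord w y - t y * coord w x) = 0" using sum by simp
      then have "\<forall>w\<in>verts S. coord w y = coord w x"
        using nn finite_verts[OF S(1)] \<open>t y = 1\<close> by (simp add: sum_nonneg_eq_0_iff)
      then have "(\<Sum>v\<in>verts S. coord v y *\<^sub>R v) = (\<Sum>v\<in>verts S. coord v x *\<^sub>R v)" by simp
      then show False
        using coord_props(4)[OF S(1,2)] coord_props(4)[OF S(1) xS] S(4) by simp
    qed
    moreover have "0 \<le> 1 - t y" unfolding sum[symmetric] using nn by (intro sum_nonneg)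
    ultimately show ?thesis by linarith
  qed
  have t1': "t y < 1" if "y \<in> ?M" for y
    using that t1 t0 by force
  have r_id: "r y = y" if y: "y \<in> ?L" for y
  proof -
    obtain S where "S \<in> K" "y \<in> S" "\<not> F \<subseteq> S" using y by blast
    then show ?thesis using t0 by (simp add: r_def)
  qed
  have r_S: "r y \<in> S \<and> r y \<in> ?L \<and> x \<notin> closed_segment y (r y)" if S: "S \<in> K" "y \<in> S" "y \<noteq> x" for S y
  proof (cases "F \<subseteq> S")
    case False
    then have "y \<in> ?L" using S by blast
    then show ?thesis using S r_id by auto
  next
    case True
    have sub: "verts F \<subseteq> verts S" using True subset_iff_verts[OF F S(1)] by blast
    have xS: "x \<in> S" using True xF by blast
    have lt: "t y < 1" using t1 S True by blast
    have nn: "0 \<le> coord w y - t y * coord w x" for w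
      using t_le[of w y] coord_x0[of w] coord_props(1)[OF S(1,2), of w] by (cases "w \<in> verts F") auto
    define u where "u w = (coord w y - t y * coord w x) / (1 - t y)" for w
    have u0: "0 \<le> u w" for w unfolding u_def using nn lt by simp
    have u1: "sum u (verts S) = 1"
      using coord_props(3)[OF S(1,2)] coord_props(3)[OF S(1) xS] lt
      by (simp add: u_def sum_subtractf flip: sum_distrib_left sum_divide_distrib)
    have "(\<Sum>v\<in>verts S. u v *\<^sub>R v)
        = (1 / (1 - t y)) *\<^sub>R (\<Sum>v\<in>verts S. (coord v y - t y * coord v x) *\<^sub>R v)"
      by (simp add: u_def scaleR_sum_right)
    also have "(\<Sum>v\<in>verts S. (coord v y - t y * coord v x) *\<^sub>R v)
        = (\<Sum>v\<in>verts S. coord v y *\<^sub>R v) - t y *\<^sub>R (\<Sum>v\<in>verts S. coord v x *\<^sub>R v)"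
      by (simp add: scaleR_diff_left sum_subtractf scaleR_sum_right)
    finally have r: "r y = (\<Sum>v\<in>verts S. u v *\<^sub>R v)"
      unfolding coord_props(4)[OF S(1,2)] coord_props(4)[OF S(1) xS] r_def by simp
    have rS: "r y \<in> S" unfolding r by (rule coord_sum(1)[OF S(1) u0 u1])
    obtain w where w: "w \<in> verts F" "t y * coord w x = coord w y" using t_att by blast
    then have uw: "u w = 0" "w \<in> verts S" using sub by (auto simp: u_def)
    \<comment> \<open>At \<open>w\<close> the minimum is attained and the coordinate of
      \<open>r y\<close> vanishes. So \<open>r y\<close> lies in the face of \<open>S\<close>
      opposite to \<open>w\<close>, which does not contain \<open>F\<close>.\<close>
    let ?G = "convex hull (verts S - {w})"
    have G: "?G \<in> K" "verts ?G = verts S - {w}"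
      using hull_subset_K[OF S(1), of "verts S - {w}"] by auto
    have "(\<Sum>v\<in>verts S - {w}. u v *\<^sub>R v) \<in> ?G"
      using coord_sum(1)[OF G(1), of u] u0 u1 uw finite_verts[OF S(1)] unfolding G(2)
      by (simp add: sum_diff1)
    then have "r y \<in> ?G"
      unfolding r using uw finite_verts[OF S(1)] by (simp add: sum.remove[of "verts S" w])
    moreover have "\<not> F \<subseteq> ?G" using subset_iff_verts[OF F G(1)] G(2) w(1) by blast
    ultimately have rL: "r y \<in> ?L" using G(1) by blast
    \<comment> \<open>Along the segment the \<open>w\<close>-coordinate shrinks linearly from
      \<open>t y * coord w x\<close> to 0, so it stays strictly below \<open>coord w x\<close> and
      the linear homotopy avoids \<open>x\<close>.\<close>
    have "x \<noteq> z" if z: "z \<in> closed_segment y (r y)" for z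
    proof -
      obtain s where s: "0 \<le> s" "s \<le> 1" "z = (1 - s) *\<^sub>R y + s *\<^sub>R r y"
        using z by (auto simp: closed_segment_def)
      define c where "c v = (1 - s) * coord v y + s * u v" for v
      have zc: "z = (\<Sum>v\<in>verts S. c v *\<^sub>R v)"
        unfolding s(3) r coord_props(4)[OF S(1,2), symmetric, THEN arg_cong[of _ _ "\<lambda>y. (1 - s) *\<^sub>R y"]]
        by (simp add: c_def scaleR_add_left sum.distrib scaleR_sum_right)
      have "0 \<le> c v" for v
        unfolding c_def using s u0[of v] coord_props(1)[OF S(1,2), of v] by simp
      moreover have "sum c (verts S) = 1"
        using u1 coord_props(3)[OF S(1,2)]
        by (simp add: c_def sum.distrib flip: sum_distrib_left)
      ultimately have "coord w z = c w"
        unfolding zc using coord_sum(2)[OF S(1), of c w] uw(2) by simp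
      also have "\<dots> = (1 - s) * t y * coord w x"
        using w(2) uw(1) by (simp add: c_def)
      also have "\<dots> < 1 * coord w x"
      proof (rule mult_strict_right_mono[OF _ pos[OF w(1)]])
        have "(1 - s) * t y \<le> 1 * t y"
          using s t_nonneg[OF S(1,2)] by (intro mult_right_mono) auto
        then show "(1 - s) * t y < 1" using lt by simp
      qed
      finally show ?thesis by auto
    qed
    then show ?thesis using rS rL by blast
  qed
  have cont_t: "continuous_on (\<Union>K) t"
    unfolding t_def[abs_def]
    by (intro continuous_on_Min[OF fin ne] continuous_on_divide continuous_coord continuous_on_const)
      (metis less_irrefl pos)
  have cont: "continuous_on ?M r"
    unfolding r_def using t1' continuous_on_subset[OF cont_t, of ?M]
    by (intro continuous_intros) (auto simp: less_imp_neq)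
  have rM: "r y \<in> ?L" if "y \<in> ?M" for y
    using that r_S by blast
  have LM: "?L \<subseteq> ?M" using xF subset_of_rel_interior[OF F _ x] by blast
  have "homotopic_with_canon (\<lambda>h. True) ?M ?M r id"
  proof (rule homotopic_with_symD, rule homotopic_with_linear)
    fix y assume y: "y \<in> ?M"
    then obtain S where S: "S \<in> K" "y \<in> S" "y \<noteq> x" by blast
    then have "closed_segment y (r y) \<subseteq> S"
      using r_S convex_K by (meson closed_segment_subset)
    then show "closed_segment (id y) (r y) \<subseteq> ?M"
      using S r_S by auto
  qed (use cont in auto)
  moreover have "retraction_maps (top_of_set ?M) (top_of_set ?L) r id"
  proof -
    have "r \<in> ?M \<rightarrow> ?L" using rM by (rule Pi_I)
    moreover have "id \<in> ?L \<rightarrow> ?M" unfolding id_def by (rule Pi_I) (rule subsetD[OF LM])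
    ultimately show ?thesis
      unfolding retraction_maps_def continuous_map_subtopology_eu topspace_euclidean_subtopology id_apply
      by (intro conjI ballI cont continuous_on_id continuous_on_id' r_id)
  qed
  ultimately show ?thesis
    using deformation_retract_imp_isomorphic_homology_groups by blast
qed

end

subsection \<open>Local homology\<close>

text \<open>Excision of \<open>M - R\<close>, a closed set inside the open set
  \<open>M - {x}\<close>.\<close>

lemma local_homology_open:
  fixes M :: "'a::t1_space set"
  assumes R: "openin (top_of_set M) R" and x: "x \<in> R"
  shows "relative_homology_group p (top_of_set R) (R - {x}) \<cong> relative_homology_group p (top_of_set M) (M - {x})"
proof -
  have RM: "R \<subseteq> M" using R openin_imp_subset by blast
  have "closedin (top_of_set M) (M - R)"
    using R by (simp add: closedin_diff)
  moreover have "openin (top_of_set M) (M - {x})"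
    unfolding openin_open Diff_eq by (intro exI[of _ "- {x}"]) (simp add: open_Compl)
  ultimately have "top_of_set M closure_of (M - R) \<subseteq> top_of_set M interior_of (M - {x})"
    using x by (auto simp: closure_of_closedin interior_of_openin)
  from is_isoI[OF homology_excision_axiom[OF this, of M p]]
  have "relative_homology_group p (subtopology (top_of_set M) (M - (M - R))) (M - {x} - (M - R))
      \<cong> relative_homology_group p (subtopology (top_of_set M) M) (M - {x})"
    by blast
  moreover have "M - (M - R) = R" "M - {x} - (M - R) = R - {x}"
    using RM by auto
  ultimately show ?thesis
    using RM by (simp add: subtopology_subtopology Int_absorb1)
qed

text \<open>A homeomorphism to Euclidean space may send \<open>x\<close> to any point
  \<open>f x\<close>. Moving that point to the origin uses that complements of homeomorphic closed
  subsets have isomorphic relative homology.\<close>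

lemma local_homology_affine:
  fixes A :: "'a::euclidean_space set"
  assumes A: "affine A" "aff_dim A = int d" and x: "x \<in> A"
  shows "relative_homology_group p (top_of_set A) (A - {x}) \<cong>
    relative_homology_group p (Euclidean_space d) (topspace (Euclidean_space d) - {\<lambda>i. 0})"
proof -
  let ?E = "Euclidean_space d"
  have "top_of_set A homeomorphic_space ?E"
    using homeomorphic_affine_Euclidean_space[OF A(1)] A(2) by simp
  then obtain f where f: "homeomorphic_map (top_of_set A) ?E f"
    unfolding homeomorphic_space by blast
  have fA: "f ` A = topspace ?E" and inj: "inj_on f A"
    using homeomorphic_imp_surjective_map[OF f] homeomorphic_imp_injective_map[OF f] by simp_all
  have fx: "f x \<in> topspace ?E" using fA x by blast
  have zero: "(\<lambda>i. 0) \<in> topspace ?E" by (simp add: topspace_Euclidean_space)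
  have img: "f ` (A - {x}) = topspace ?E - {f x}"
    using fA x inj_on_image_set_diff[OF inj, of A "{x}"] by simp
  have sub: "A - {x} \<subseteq> topspace (top_of_set A)" by simp
  have "relative_homology_group p (top_of_set A) (A - {x}) \<cong>
      relative_homology_group p ?E (topspace ?E - {f x})"
    by (rule is_isoI[OF homeomorphic_map_relative_homology_iso[OF f sub img]])
  moreover have "relative_homology_group p ?E (topspace ?E - {f x}) \<cong>
      relative_homology_group p ?E (topspace ?E - {\<lambda>i. 0})"
  proof (rule isomorphic_relative_homology_groups_Euclidean_complements)
    show "closedin ?E {f x}" "closedin ?E {\<lambda>i. 0}"
      using closedin_Hausdorff_singleton[OF Hausdorff_Euclidean_space fx]
        closedin_Hausdorff_singleton[OF Hausdorff_Euclidean_space zero] by simp_all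
    have "homeomorphic_maps (subtopology ?E {f x}) (subtopology ?E {\<lambda>i. 0}) (\<lambda>_ _. 0) (\<lambda>_. f x)"
      using fx zero by (auto simp: homeomorphic_maps_def)
    then show "subtopology ?E {f x} homeomorphic_space subtopology ?E {\<lambda>i. 0}"
      unfolding homeomorphic_space_def by blast
  qed
  ultimately show ?thesis by (rule iso_trans)
qed

context simplicial
begin

lemma rel_interior_nonempty:
  assumes "S \<in> K" "S \<noteq> {}" obtains x where "x \<in> rel_interior S"
  using rel_interior_eq_empty[OF convex_K[OF assms(1)]] assms(2) by blast

lemma verts_nonempty:
  assumes "S \<in> K" "S \<noteq> {}" shows "verts S \<noteq> {}"
  using hull_verts[OF assms(1)] assms(2) by auto

lemma aff_dim_nat:
  assumes S: "S \<in> K" "S \<noteq> {}" obtains d where "aff_dim S = int d"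
proof -
  have "0 < card (verts S)"
    using verts_nonempty[OF S] finite_verts[OF S(1)] by (simp add: card_gt_0_iff)
  then have "aff_dim S = int (card (verts S) - 1)"
    using card_verts[OF S(1)] by simp
  then show thesis by (rule that)
qed

text \<open>The complement is the finite union of the closed simplices not containing
  \<open>G\<close>: a point outside that union has a carrier containing \<open>G\<close>, and by
  maximality the carrier is \<open>G\<close>.\<close>

lemma openin_rel_interior_maximal:
  assumes G: "G \<in> K" and max: "\<And>S. S \<in> K \<Longrightarrow> G \<subseteq> S \<Longrightarrow> S = G"
  shows "openin (top_of_set (\<Union>K)) (rel_interior G)"
proof -
  let ?L = "\<Union>{S \<in> K. \<not> G \<subseteq> S}"
  have "closed ?L" using finite_K closed_K by (intro closed_Union) auto
  moreover have "rel_interior G = \<Union>K - ?L"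
  proof
    show "rel_interior G \<subseteq> \<Union>K - ?L"
    proof
      fix y assume y: "y \<in> rel_interior G"
      then have "y \<in> G" using rel_interior_subset by blast
      with y show "y \<in> \<Union>K - ?L" using G subset_of_rel_interior[OF G _ y] by blast
    qed
    show "\<Union>K - ?L \<subseteq> rel_interior G"
    proof
      fix y assume y: "y \<in> \<Union>K - ?L"
      then obtain S where S: "S \<in> K" "y \<in> S" by blast
      then obtain F where F: "F \<in> K" "y \<in> rel_interior F" using rel_interior_cover by metis
      then have "y \<in> F" using rel_interior_subset by blast
      then have "G \<subseteq> F" using y F(1) by blast
      then show "y \<in> rel_interior G" using max[OF F(1)] F(2) by simp
    qed
  qed
  ultimately show ?thesis
    unfolding openin_open Diff_eq by (intro exI[of _ "- ?L"] conjI open_Compl)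
qed

text \<open>The open simplex is open both in its affine hull and in the realization, so two
  excisions connect the two local homologies.\<close>

lemma local_homology_maximal:
  assumes G: "G \<in> K" "aff_dim G = int d" and max: "\<And>S. S \<in> K \<Longrightarrow> G \<subseteq> S \<Longrightarrow> S = G"
    and x: "x \<in> rel_interior G"
  shows "relative_homology_group p (top_of_set (\<Union>K)) (\<Union>K - {x}) \<cong>
    relative_homology_group p (Euclidean_space d) (topspace (Euclidean_space d) - {\<lambda>i. 0})"
proof -
  let ?R = "rel_interior G"
  have "x \<in> affine hull G" using x rel_interior_subset[of G] hull_subset[of G affine] by auto
  then have 1: "relative_homology_group p (top_of_set (affine hull G)) (affine hull G - {x}) \<cong>
    relative_homology_group p (Euclidean_space d) (topspace (Euclidean_space d) - {\<lambda>i. 0})"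
    using G(2) by (intro local_homology_affine) simp_all
  have 2: "relative_homology_group p (top_of_set ?R) (?R - {x}) \<cong>
      relative_homology_group p (top_of_set (affine hull G)) (affine hull G - {x})"
    by (rule local_homology_open[OF openin_rel_interior x])
  have 3: "relative_homology_group p (top_of_set ?R) (?R - {x}) \<cong>
      relative_homology_group p (top_of_set (\<Union>K)) (\<Union>K - {x})"
    by (rule local_homology_open[OF openin_rel_interior_maximal[OF G(1) max] x])
  show ?thesis
    by (rule iso_trans[OF group.iso_sym[OF group_relative_homology_group 3] iso_trans[OF 2 1]])
qed

lemma space_chi_local:
  assumes F: "F \<in> K" "x \<in> rel_interior F"
    and iso: "\<And>p. relative_homology_group p (top_of_set (\<Union>K)) (\<Union>K - {x}) \<cong>
      relative_homology_group p (Euclidean_space d) (topspace (Euclidean_space d) - {\<lambda>i. 0})"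
    and L: "space_chi (top_of_set (\<Union>{S \<in> K. \<not> F \<subseteq> S})) {} e"
  shows "space_chi (top_of_set (\<Union>K)) {} (e + (-1) ^ d)"
proof (rule space_chi_pair)
  have "space_chi (top_of_set (\<Union>K - {x})) {} e"
    using L space_chi_iso[OF punctured_homology[OF F]] by blast
  then show "space_chi (subtopology (top_of_set (\<Union>K)) (\<Union>K - {x})) {} e"
    by (simp add: subtopology_subtopology Int_absorb1)
  show "space_chi (top_of_set (\<Union>K)) (\<Union>K - {x}) ((-1) ^ d)"
    using space_chi_Euclidean space_chi_iso[OF iso] by blast
qed

end

text \<open>Induction on \<open>K\<close> by removing a maximal simplex \<open>G\<close>. The
  simplices not containing \<open>G\<close> are then exactly \<open>K - {G}\<close>, and the
  relative term \<open>(-1) ^ d\<close> at an interior point of \<open>G\<close> equals the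
  combinatorial share of \<open>G\<close>.\<close>

lemma space_chi_simplicial_complex:
  assumes "simplicial_complex K"
  shows "space_chi (top_of_set (\<Union>K)) {} (euler_char K)"
proof -
  have "finite K" using assms by (simp add: simplicial_complex_def)
  then show ?thesis using assms
  proof (induction K rule: finite_psubset_induct)
    case (psubset K)
    interpret simplicial K by unfold_locales fact
    show ?case
    proof (cases "K \<subseteq> {{}}")
      case True
      then have "\<Union>K = {}" "K - {{}} = {}" by auto
      then show ?thesis using space_chi_empty by (simp only: euler_char_def sum.empty)
    next
      case False
      then have "finite (K - {{}})" "K - {{}} \<noteq> {}" using psubset.hyps by auto
      then obtain G where G: "G \<in> K - {{}}" "\<And>S. S \<in> K - {{}} \<Longrightarrow> G \<subseteq> S \<Longrightarrow> G = S"
        using finite_has_maximal by metis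
      then have max: "S = G" if "S \<in> K" "G \<subseteq> S" for S using that by blast
      have GK: "G \<in> K" using G by blast
      obtain d where d: "aff_dim G = int d"
        using G aff_dim_nat[of G] by blast
      obtain x where x: "x \<in> rel_interior G" using G rel_interior_nonempty by blast
      have eq: "{S \<in> K. \<not> G \<subseteq> S} = K - {G}" using max by blast
      have "simplicial_complex (K - {G})"
      proof (rule simplicial_sub)
        fix S F assume "S \<in> K - {G}" "F face_of S"
        then show "F \<in> K - {G}" using max face_K face_of_imp_subset by blast
      qed blast
      moreover have "K - {G} \<subset> K" using GK by blast
      ultimately have "space_chi (top_of_set (\<Union>{S \<in> K. \<not> G \<subseteq> S})) {} (euler_char (K - {G}))"
        unfolding eq by (intro psubset.IH)
      then have "space_chi (top_of_set (\<Union>K)) {} (euler_char (K - {G}) + (-1) ^ d)"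
        by (intro space_chi_local[OF GK x] local_homology_maximal[OF GK d max x])
      moreover have "euler_char K = euler_char (K - {G}) + (-1) ^ d"
      proof -
        have "euler_char K = (-1) ^ nat (aff_dim G) + (\<Sum>F\<in>K - {{}} - {G}. (-1) ^ nat (aff_dim F))"
          unfolding euler_char_def using G psubset.hyps by (intro sum.remove) auto
        moreover have "K - {{}} - {G} = K - {G} - {{}}" by blast
        ultimately show ?thesis by (simp add: d euler_char_def)
      qed
      ultimately show ?thesis by simp
    qed
  qed
qed

section \<open>Homology manifolds: dimension of maximal simplices and Euler characteristic of
  stars\<close>

locale manifold_complex = simplicial K for K :: "'a::euclidean_space set set" +
  fixes n :: nat
  assumes local_homology: "\<And>x p. x \<in> \<Union>K \<Longrightarrow>
    relative_homology_group p (top_of_set (\<Union>K)) (\<Union>K - {x}) \<cong>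
    relative_homology_group p (Euclidean_space n) (topspace (Euclidean_space n) - {\<lambda>i. 0})"
begin

lemma aff_dim_maximal:
  assumes G: "G \<in> K" "G \<noteq> {}" and max: "\<And>S. S \<in> K \<Longrightarrow> G \<subseteq> S \<Longrightarrow> S = G"
  shows "aff_dim G = int n"
proof -
  obtain d where d: "aff_dim G = int d"
    using aff_dim_nat[OF G] by blast
  obtain x where x: "x \<in> rel_interior G" using G rel_interior_nonempty by blast
  then have xK: "x \<in> \<Union>K" using G rel_interior_subset by blast
  note 1 = grank_iso[OF local_homology_maximal[OF G(1) d max x, of "int d"]]
  note 2 = grank_iso[OF local_homology[OF xK, of "int d"]]
  \<comment> \<open>In degree \<open>d\<close> the local homology has rank 1 because
    \<open>G\<close> is maximal; the manifold condition gives rank 1 there only if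
    \<open>d = n\<close>.\<close>
  have "(if int d = int n then 1 else (0::enat)) = 1"
    using 1 2 by (simp add: grank_Euclidean)
  then show ?thesis using d by (simp split: if_splits)
qed

lemma ex_facet:
  assumes F: "F \<in> K" "F \<noteq> {}"
  obtains G where "G \<in> K" "F \<subseteq> G" "aff_dim G = int n"
proof -
  obtain G where G: "G \<in> K" "F \<subseteq> G" "\<And>S. S \<in> K \<Longrightarrow> G \<subseteq> S \<Longrightarrow> G = S"
    using finite_has_maximal2[OF finite_K F(1)] by metis
  then have "aff_dim G = int n" using F by (intro aff_dim_maximal) auto
  then show thesis using that G by blast
qed

lemma aff_dim_le:
  assumes "F \<in> K" shows "aff_dim F \<le> int n"
proof (cases "F = {}")
  case False
  obtain G where "F \<subseteq> G" "aff_dim G = int n" using ex_facet[OF assms False] by blast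
  then show ?thesis using aff_dim_subset by metis
qed simp

text \<open>Compared with the simplices not containing \<open>F\<close>, the Euler characteristic of
  \<open>K\<close> grows by \<open>(-1) ^ n\<close> topologically and by the sum over the simplices
  containing \<open>F\<close> combinatorially.\<close>

lemma local_euler_char:
  assumes F: "F \<in> K" "F \<noteq> {}"
  shows "(\<Sum>G | G \<in> K \<and> F \<subseteq> G. (-1) ^ nat (aff_dim G)) = (-1 :: int) ^ n"
proof -
  let ?L = "{S \<in> K. \<not> F \<subseteq> S}"
  obtain x where x: "x \<in> rel_interior F" using F rel_interior_nonempty by blast
  then have xK: "x \<in> \<Union>K" using F rel_interior_subset by blast
  have "simplicial_complex ?L"
  proof (rule simplicial_sub)
    fix S F' assume "S \<in> ?L" "F' face_of S"
    then show "F' \<in> ?L" using face_K face_of_imp_subset by blast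
  qed blast
  then have "space_chi (top_of_set (\<Union>K)) {} (euler_char ?L + (-1) ^ n)"
    by (intro space_chi_local[OF F(1) x local_homology[OF xK]] space_chi_simplicial_complex)
  then have "euler_char K = euler_char ?L + (-1) ^ n"
    by (rule space_chi_unique[OF space_chi_simplicial_complex[OF K]])
  moreover have "euler_char K = euler_char ?L + (\<Sum>G | G \<in> K \<and> F \<subseteq> G. (-1) ^ nat (aff_dim G))"
  proof -
    have "K - {{}} = (?L - {{}}) \<union> {G. G \<in> K \<and> F \<subseteq> G}"
      using F by auto
    then show ?thesis
      unfolding euler_char_def using finite_K by (simp only:) (subst sum.union_disjoint, auto)
  qed
  ultimately show ?thesis by linarith
qed

end

subsection \<open>Tiles\<close>

text \<open>Lets the facts of the locale be applied inside a single simplex, where tiles are defined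
  without reference to an ambient complex.\<close>

lemma simplicial_faces:
  assumes "n simplex S" shows "simplicial {F. F face_of S}"
  unfolding simplicial_def simplicial_complex_def
proof (intro conjI allI impI ballI)
  show "finite {F. F face_of S}"
    using assms finite_polytope_faces simplex_imp_polytope by blast
next
  fix F assume "F \<in> {F. F face_of S}"
  then obtain U where U: "U \<subseteq> verts S" "F = convex hull U"
    using simplex_face_iff[OF assms] by auto
  then have "\<not> affine_dependent U"
    using simplex_verts(1)[OF assms] affine_dependent_subset by blast
  then show "\<exists>n. n simplex F"
    unfolding U(2) simplex_def by (intro exI[of _ "int (card U) - 1"] exI[of _ U]) simp
next
  fix F G assume "G \<in> {F. F face_of S} \<and> F face_of G"
  then show "F \<in> {F. F face_of S}" using face_of_trans by auto
next
  fix F G assume *: "F \<in> {F. F face_of S} \<and> G \<in> {F. F face_of S}"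
  then have "F \<inter> G face_of S" by (simp add: face_of_Int)
  then show "F \<inter> G face_of F"
    by (rule face_of_subset) (use * face_of_imp_subset in auto)
qed

lemma mem_simplex_face_iff:
  assumes S: "n simplex S" and U: "U \<subseteq> verts S" "U' \<subseteq> verts S" and y: "y \<in> rel_interior (convex hull U)"
  shows "y \<in> convex hull U' \<longleftrightarrow> U \<subseteq> U'"
proof
  interpret simplicial "{F. F face_of S}" by (rule simplicial_faces[OF S])
  have "convex hull U \<in> {F. F face_of S}" "convex hull U' \<in> {F. F face_of S}"
    using simplex_face_iff[OF S] U by auto
  moreover assume "y \<in> convex hull U'"
  ultimately have "verts (convex hull U) \<subseteq> verts (convex hull U')"
    using subset_of_rel_interior[OF _ _ y] subset_iff_verts by simp
  then show "U \<subseteq> U'" using simplex_verts_face[OF S] U by simp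
next
  assume "U \<subseteq> U'"
  then show "y \<in> convex hull U'" using y rel_interior_subset hull_mono by (meson subsetD)
qed

lemma card_face_verts:
  assumes S: "n simplex S" and U: "U \<subseteq> verts S"
  shows "aff_dim (convex hull U) = int (card U) - 1"
proof -
  have "\<not> affine_dependent U" using affine_dependent_subset simplex_verts(1)[OF S] U by blast
  then show ?thesis by (simp add: aff_dim_convex_hull aff_dim_affine_independent)
qed

lemma simplex_facets:
  assumes S: "int d simplex S"
  shows "{F. F face_of S \<and> aff_dim F = int d - 1} = (\<lambda>w. convex hull (verts S - {w})) ` verts S"
    (is "?A = ?f ` _")
proof
  have card: "card (verts S) = d + 1" "finite (verts S)" using simplex_verts[OF S] by auto
  show "?A \<subseteq> ?f ` verts S"
  proof
    fix F assume F: "F \<in> ?A"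
    then obtain U where U: "U \<subseteq> verts S" "F = convex hull U"
      using simplex_face_iff[OF S] by auto
    then have "card U = d" using F card_face_verts[OF S U(1)] by simp
    then have "card (verts S - U) = 1"
      using card U(1) by (simp add: card_Diff_subset finite_subset)
    then obtain w where w: "verts S - U = {w}" by (auto simp: card_1_singleton_iff)
    then have "U = verts S - {w}" using U(1) by blast
    then show "F \<in> ?f ` verts S" using U(2) w by blast
  qed
  show "?f ` verts S \<subseteq> ?A"
  proof
    fix F assume "F \<in> ?f ` verts S"
    then obtain w where w: "w \<in> verts S" "F = ?f w" by blast
    have "F face_of S" unfolding w(2) simplex_face_iff[OF S] by (intro exI[of _ "verts S - {w}"]) simp
    moreover have "aff_dim F = int d - 1"
      unfolding w(2) using card_face_verts[OF S, of "verts S - {w}"] w(1) card by simp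
    ultimately show "F \<in> ?A" by simp
  qed
qed

text \<open>\<open>W\<close> collects the vertices opposite to the removed facets: a point avoids
  the facet opposite to \<open>w\<close> iff its carrier has \<open>w\<close> as a vertex. Tiles
  thereby become upper intervals in the lattice of vertex sets.\<close>

lemma basic_tile_verts:
  assumes "basic_tile d k S T"
  obtains W where "W \<subseteq> verts S" "card W = k"
    "\<And>U y. U \<subseteq> verts S \<Longrightarrow> y \<in> rel_interior (convex hull U) \<Longrightarrow> y \<in> T \<longleftrightarrow> W \<subseteq> U"
proof -
  have S: "int d simplex S" using assms by (simp add: basic_tile_def)
  obtain A where A: "A \<subseteq> (\<lambda>w. convex hull (verts S - {w})) ` verts S" "card A = k" "T = S - \<Union>A"
    using assms unfolding basic_tile_def simplex_facets[OF S] by blast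
  obtain W where W: "W \<subseteq> verts S" "inj_on (\<lambda>w. convex hull (verts S - {w})) W"
    "A = (\<lambda>w. convex hull (verts S - {w})) ` W"
    using A(1) unfolding subset_image_inj by blast
  show thesis
  proof (rule that[OF W(1)])
    show "card W = k" using A(2) W(2,3) by (simp add: card_image)
    fix U y assume U: "U \<subseteq> verts S" and y: "y \<in> rel_interior (convex hull U)"
    have "y \<in> S"
      using mem_simplex_face_iff[OF S U order_refl y] U simplex_verts(2)[OF S] by simp
    moreover have "y \<in> convex hull (verts S - {w}) \<longleftrightarrow> w \<notin> U" for w
      using mem_simplex_face_iff[OF S U _ y, of "verts S - {w}"] U by blast
    ultimately show "y \<in> T \<longleftrightarrow> W \<subseteq> U" unfolding A(3) W(3) by blast
  qed
qed

lemma rel_interior_hull_nonempty: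
  fixes U :: "'a::euclidean_space set"
  assumes "U \<noteq> {}"
  obtains y where "y \<in> rel_interior (convex hull U)"
  using rel_interior_eq_empty[of "convex hull U"] assms by auto

text \<open>The removed face has \<open>k\<close> vertices, and they include the \<open>k\<close>
  vertices of \<open>W\<close>; so it is spanned by \<open>W\<close>, and inclusion becomes
  strict.\<close>

lemma critical_tile_verts:
  assumes "critical_tile d k S T"
  obtains W where "W \<subseteq> verts S" "card W = k"
    "\<And>U y. U \<subseteq> verts S \<Longrightarrow> y \<in> rel_interior (convex hull U) \<Longrightarrow> y \<in> T \<longleftrightarrow> W \<subset> U"
proof -
  obtain B F where B: "basic_tile d k S B" and F: "F face_of S" "aff_dim F = int k - 1"
      "rel_interior F \<subseteq> B" and T: "T = B - F"
    using assms by (auto simp: critical_tile_def)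
  have S: "int d simplex S" using B by (simp add: basic_tile_def)
  obtain W where W: "W \<subseteq> verts S" "card W = k"
    "\<And>U y. U \<subseteq> verts S \<Longrightarrow> y \<in> rel_interior (convex hull U) \<Longrightarrow> y \<in> B \<longleftrightarrow> W \<subseteq> U"
    using basic_tile_verts[OF B] by metis
  obtain U0 where U0: "U0 \<subseteq> verts S" "F = convex hull U0"
    using F(1) simplex_face_iff[OF S] by auto
  have fin: "finite U0" "finite W"
    using U0(1) W(1) simplex_verts(4)[OF S] finite_subset by auto
  have card: "card U0 = k" using F(2) card_face_verts[OF S U0(1)] U0(2) by simp
  \<comment> \<open>For empty \<open>U0\<close> the condition on \<open>rel_interior F\<close> is
    void, but then \<open>k = 0\<close> and \<open>W\<close> is empty too.\<close>
  have "W \<subseteq> U0"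
  proof (cases "U0 = {}")
    case True
    then show ?thesis using card W(2) fin by simp
  next
    case False
    obtain y where y: "y \<in> rel_interior (convex hull U0)"
      using rel_interior_hull_nonempty[OF False] by blast
    then have "y \<in> B" using F(3) U0(2) by blast
    then show ?thesis using W(3)[OF U0(1) y] by simp
  qed
  then have "U0 = W" using card W(2) fin card_subset_eq by metis
  show thesis
  proof (rule that[OF W(1,2)])
    fix U y assume U: "U \<subseteq> verts S" and y: "y \<in> rel_interior (convex hull U)"
    show "y \<in> T \<longleftrightarrow> W \<subset> U"
      unfolding T U0(2) \<open>U0 = W\<close> using W(3)[OF U y] mem_simplex_face_iff[OF S U W(1) y] by blast
  qed
qed

lemma tile_simplex:
  assumes "tile d S T"
  shows "int d simplex S" "T \<subseteq> S" "rel_interior S \<subseteq> T"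
proof -
  have *: "int d simplex S \<and> T \<subseteq> S"
    using assms by (auto simp: tile_def basic_tile_def critical_tile_def)
  then show S: "int d simplex S" and "T \<subseteq> S" by auto
  note V = simplex_verts[OF S]
  show "rel_interior S \<subseteq> T"
  proof
    fix y assume "y \<in> rel_interior S"
    then have y: "y \<in> rel_interior (convex hull (verts S))" using V(2) by simp
    consider k where "basic_tile d k S T" | k where "critical_tile d k S T"
      using assms by (auto simp: tile_def)
    then show "y \<in> T"
    proof cases
      case (1 k)
      show ?thesis using basic_tile_verts[OF 1] order_refl y by metis
    next
      case (2 k)
      obtain W where W: "W \<subseteq> verts S" "card W = k"
        "\<And>U y. U \<subseteq> verts S \<Longrightarrow> y \<in> rel_interior (convex hull U) \<Longrightarrow> y \<in> T \<longleftrightarrow> W \<subset> U"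
        using critical_tile_verts[OF 2] by metis
      \<comment> \<open>This uses the bound \<open>k \<le> d\<close> for critical tiles: the removed
        face is never the whole simplex.\<close>
      have "card W < card (verts S)" using W(2) 2 V(3) by (simp add: critical_tile_def)
      then have "W \<subset> verts S" using W(1) by auto
      then show ?thesis using W(3)[OF order_refl y] by simp
    qed
  qed
qed

text \<open>A tile lies between the open and the closed simplex, so its closure is the
  simplex.\<close>

lemma tile_unique:
  assumes "tile d S T" "tile d' S' T"
  shows "S = S'" "d = d'"
proof -
  have cl: "closure T = S" if "tile d S T" for d S
  proof
    note t = tile_simplex[OF that]
    show "closure T \<subseteq> S" using t(1,2) closed_simplex closure_minimal by blast
    show "S \<subseteq> closure T"
      using t(3) convex_closure_rel_interior[OF convex_simplex[OF t(1)]] closure_mono closure_subset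
      by (metis order_trans)
  qed
  show "S = S'" using cl assms by blast
  then show "d = d'"
    using aff_dim_simplex[OF tile_simplex(1)[OF assms(1)]] aff_dim_simplex[OF tile_simplex(1)[OF assms(2)]]
    by simp
qed

text \<open>The minimal open faces of a critical tile have one vertex more than its index. Adjoining
  a vertex to \<open>W1\<close>, possible since \<open>k1 \<le> d\<close>, gives an open face of the
  tile, which must strictly contain \<open>W2\<close>.\<close>

lemma critical_tile_unique:
  assumes "critical_tile d k S T" "critical_tile d' k' S' T"
  shows "d = d'" "k = k'"
proof -
  have t: "tile d S T" "tile d' S' T" using assms by (auto simp: tile_def)
  show "d = d'" by (rule tile_unique(2)[OF t])
  have "S = S'" by (rule tile_unique(1)[OF t])
  have S: "int d simplex S" by (rule tile_simplex(1)[OF t(1)])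
  have le: "k2 \<le> k1" if c1: "critical_tile d k1 S T" and c2: "critical_tile d k2 S T" for k1 k2
  proof -
    obtain W1 where W1: "W1 \<subseteq> verts S" "card W1 = k1"
      "\<And>U y. U \<subseteq> verts S \<Longrightarrow> y \<in> rel_interior (convex hull U) \<Longrightarrow> y \<in> T \<longleftrightarrow> W1 \<subset> U"
      using critical_tile_verts[OF c1] by metis
    obtain W2 where W2: "W2 \<subseteq> verts S" "card W2 = k2"
      "\<And>U y. U \<subseteq> verts S \<Longrightarrow> y \<in> rel_interior (convex hull U) \<Longrightarrow> y \<in> T \<longleftrightarrow> W2 \<subset> U"
      using critical_tile_verts[OF c2] by metis
    have fin: "finite W1" using W1(1) simplex_verts(4)[OF S] finite_subset by auto
    have "card W1 < card (verts S)"
      using W1(2) c1 simplex_verts(3)[OF S] by (simp add: critical_tile_def)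
    then have "verts S \<noteq> W1" by auto
    then obtain v where v: "v \<in> verts S" "v \<notin> W1" using W1(1) by blast
    have U: "insert v W1 \<subseteq> verts S" using v W1(1) by blast
    obtain y where y: "y \<in> rel_interior (convex hull (insert v W1))"
      using rel_interior_hull_nonempty[of "insert v W1"] by blast
    have "W1 \<subset> insert v W1" using v by blast
    then have "W2 \<subset> insert v W1" using W1(3)[OF U y] W2(3)[OF U y] by simp
    then have "card W2 < card (insert v W1)" using fin by (intro psubset_card_mono) auto
    then show ?thesis using W1(2) W2(2) v(2) fin by simp
  qed
  show "k = k'"
    using le assms \<open>d = d'\<close> \<open>S = S'\<close> by (metis order_antisym)
qed

text \<open>The face taken away is the empty one. Consequently a tile that is not critical has
  positive order.\<close>

lemma basic_tile_0_critical:
  assumes "basic_tile d 0 S T" shows "critical_tile d 0 S T"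
proof -
  have S: "int d simplex S" using assms by (simp add: basic_tile_def)
  have "rel_interior {} \<subseteq> T" by simp
  then show ?thesis unfolding critical_tile_def
    using assms by (intro conjI exI[of _ T] exI[of _ "{}"]) (auto)
qed

text \<open>For positive order the least open face of the tile is nonempty and determines
  \<open>W\<close>. Order 0 must be excluded, since a point also has order 1.\<close>

lemma basic_tile_order_unique:
  assumes "basic_tile d j S T" "basic_tile d' j' S' T" "0 < j" "0 < j'"
  shows "j = j'"
proof -
  have t: "tile d S T" "tile d' S' T" using assms by (auto simp: tile_def)
  have eq: "d = d'" "S = S'" using tile_unique[OF t] by auto
  have S: "int d simplex S" by (rule tile_simplex(1)[OF t(1)])
  have le: "j2 \<le> j1" if c1: "basic_tile d j1 S T" and c2: "basic_tile d j2 S T" and c3: "0 < j1" for j1 j2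
  proof -
    obtain W1 where W1: "W1 \<subseteq> verts S" "card W1 = j1"
      "\<And>U y. U \<subseteq> verts S \<Longrightarrow> y \<in> rel_interior (convex hull U) \<Longrightarrow> y \<in> T \<longleftrightarrow> W1 \<subseteq> U"
      using basic_tile_verts[OF c1] by metis
    obtain W2 where W2: "W2 \<subseteq> verts S" "card W2 = j2"
      "\<And>U y. U \<subseteq> verts S \<Longrightarrow> y \<in> rel_interior (convex hull U) \<Longrightarrow> y \<in> T \<longleftrightarrow> W2 \<subseteq> U"
      using basic_tile_verts[OF c2] by metis
    have fin: "finite W1" using W1(1) simplex_verts(4)[OF S] finite_subset by auto
    have "W1 \<noteq> {}" using W1(2) c3 by auto
    then obtain y where y: "y \<in> rel_interior (convex hull W1)"
      using rel_interior_hull_nonempty[of W1] by blast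
    have "W2 \<subseteq> W1" using W1(3)[OF W1(1) y] W2(3)[OF W1(1) y] by simp
    then show ?thesis using card_mono[OF fin] W1(2) W2(2) by blast
  qed
  show ?thesis using le assms eq by (metis order_antisym)
qed

lemma sum_pow_card_supersets:
  fixes y :: real
  assumes V: "finite V" "W \<subseteq> V"
  shows "(\<Sum>U | W \<subseteq> U \<and> U \<subseteq> V. y ^ card U) = y ^ card W * (1 + y) ^ (card V - card W)"
proof -
  have finW: "finite W" using V finite_subset by blast
  have "(\<Sum>U | W \<subseteq> U \<and> U \<subseteq> V. y ^ card U) = (\<Sum>U\<in>Pow (V - W). y ^ card (W \<union> U))"
    by (rule sum.reindex_bij_witness[of _ "\<lambda>U. W \<union> U" "\<lambda>U. U - W"]) (use V in \<open>auto simp: Un_absorb1\<close>)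
  also have "\<dots> = (\<Sum>U\<in>Pow (V - W). y ^ card W * y ^ card U)"
  proof (rule sum.cong[OF refl])
    fix U assume "U \<in> Pow (V - W)"
    then have "finite U" "W \<inter> U = {}" using V by (auto intro: finite_subset[OF _ V(1)])
    then show "y ^ card (W \<union> U) = y ^ card W * y ^ card U"
      using finW by (simp add: card_Un_disjoint power_add)
  qed
  also have "\<dots> = y ^ card W * (\<Sum>U\<in>Pow (V - W). (\<Prod>v\<in>U. y) * (\<Prod>v\<in>V - W - U. 1))"
    by (simp add: sum_distrib_left)
  also have "\<dots> = y ^ card W * (\<Prod>v\<in>V - W. y + 1)"
    using V by (subst prod_add) auto
  also have "\<dots> = y ^ card W * (1 + y) ^ (card V - card W)"
    using V finW by (simp add: card_Diff_subset add.commute)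
  finally show ?thesis .
qed

section \<open>Counting the open faces of a tile\<close>

context simplicial
begin

text \<open>The empty simplex is left out because its relative interior is empty and would count for
  every tile.\<close>

definition face_sum :: "'a set \<Rightarrow> real \<Rightarrow> real" where
  "face_sum T y = (\<Sum>F | F \<in> K - {{}} \<and> rel_interior F \<subseteq> T. y ^ card (verts F))"

lemma face_sum_verts:
  assumes S: "S \<in> K" "T \<subseteq> S"
    and P: "\<And>U y. U \<subseteq> verts S \<Longrightarrow> y \<in> rel_interior (convex hull U) \<Longrightarrow> y \<in> T \<longleftrightarrow> P U"
  shows "face_sum T y = (\<Sum>U | P U \<and> U \<noteq> {} \<and> U \<subseteq> verts S. y ^ card U)"
  unfolding face_sum_def
proof (rule sum.reindex_bij_witness[of _ "\<lambda>U. convex hull U" verts])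
  fix F assume F: "F \<in> {F. F \<in> K - {{}} \<and> rel_interior F \<subseteq> T}"
  then have FK: "F \<in> K" "F \<noteq> {}" by auto
  then obtain x where x: "x \<in> rel_interior F" using rel_interior_nonempty by metis
  have xT: "x \<in> T" using F x by blast
  then have "F \<subseteq> S" using subset_of_rel_interior[OF FK(1) S(1) x] S(2) by blast
  then have sub: "verts F \<subseteq> verts S" using subset_iff_verts[OF FK(1) S(1)] by blast
  show h: "convex hull (verts F) = F" by (rule hull_verts[OF FK(1)])
  have "P (verts F)" using P[OF sub, of x] x xT unfolding h by simp
  then show "verts F \<in> {U. P U \<and> U \<noteq> {} \<and> U \<subseteq> verts S}"
    using sub verts_nonempty[OF FK] by simp
next
  fix U assume U: "U \<in> {U. P U \<and> U \<noteq> {} \<and> U \<subseteq> verts S}"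
  then have h: "convex hull U \<in> K" "verts (convex hull U) = U"
    using hull_subset_K[OF S(1)] by auto
  show "verts (convex hull U) = U" by (rule h)
  have "rel_interior (convex hull U) \<subseteq> T"
  proof
    fix z assume "z \<in> rel_interior (convex hull U)"
    then show "z \<in> T" using P[of U z] U by simp
  qed
  then show "convex hull U \<in> {F. F \<in> K - {{}} \<and> rel_interior F \<subseteq> T}"
    using h U by simp
qed simp

lemma face_sum_basic:
  assumes S: "S \<in> K" and T: "basic_tile d k S T" and k: "0 < k"
  shows "face_sum T y = y ^ k * (1 + y) ^ (d + 1 - k)"
proof -
  obtain W where W: "W \<subseteq> verts S" "card W = k"
    "\<And>U y. U \<subseteq> verts S \<Longrightarrow> y \<in> rel_interior (convex hull U) \<Longrightarrow> y \<in> T \<longleftrightarrow> W \<subseteq> U"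
    using basic_tile_verts[OF T] by metis
  have t: "tile d S T" using T by (auto simp: tile_def)
  have "W \<noteq> {}" using W(2) k by auto
  have face_sum: "face_sum T y = (\<Sum>U | W \<subseteq> U \<and> U \<noteq> {} \<and> U \<subseteq> verts S. y ^ card U)"
    by (rule face_sum_verts[OF S tile_simplex(2)[OF t]]) (rule W(3))
  from \<open>W \<noteq> {}\<close> have eq: "{U. W \<subseteq> U \<and> U \<noteq> {} \<and> U \<subseteq> verts S} = {U. W \<subseteq> U \<and> U \<subseteq> verts S}" by auto
  have "card (verts S) = d + 1" using simplex_verts(3)[OF tile_simplex(1)[OF t]] by simp
  then show ?thesis
    unfolding face_sum eq
    using sum_pow_card_supersets[OF finite_verts[OF S] W(1)] W(2) by simp
qed

text \<open>The subtracted \<open>y ^ k\<close> is the share of \<open>W\<close> itself. For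
  \<open>k = 0\<close> it is the empty face, which \<open>face_sum\<close> omits, so closed
  simplices need no separate case.\<close>

lemma face_sum_critical:
  assumes S: "S \<in> K" and T: "critical_tile d k S T"
  shows "face_sum T y = y ^ k * (1 + y) ^ (d + 1 - k) - y ^ k"
proof -
  obtain W where W: "W \<subseteq> verts S" "card W = k"
    "\<And>U y. U \<subseteq> verts S \<Longrightarrow> y \<in> rel_interior (convex hull U) \<Longrightarrow> y \<in> T \<longleftrightarrow> W \<subset> U"
    using critical_tile_verts[OF T] by metis
  have t: "tile d S T" using T by (auto simp: tile_def)
  have face_sum: "face_sum T y = (\<Sum>U | W \<subset> U \<and> U \<noteq> {} \<and> U \<subseteq> verts S. y ^ card U)"
    by (rule face_sum_verts[OF S tile_simplex(2)[OF t]]) (rule W(3))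
  have eq: "{U. W \<subset> U \<and> U \<noteq> {} \<and> U \<subseteq> verts S} = {U. W \<subseteq> U \<and> U \<subseteq> verts S} - {W}" by auto
  have fin: "finite {U. W \<subseteq> U \<and> U \<subseteq> verts S}"
    by (rule finite_subset[of _ "Pow (verts S)"]) (use finite_verts[OF S] in auto)
  have "card (verts S) = d + 1" using simplex_verts(3)[OF tile_simplex(1)[OF t]] by simp
  then show ?thesis
    unfolding face_sum eq
    using sum_pow_card_supersets[OF finite_verts[OF S] W(1)] W(1,2) fin by (simp add: sum_diff1)
qed

text \<open>The correction stops below \<open>n\<close> because index \<open>n\<close> gives
  \<open>y ^ n * (1 + y) - y ^ n = y ^ (n + 1)\<close>, exactly the term of order
  \<open>n + 1\<close> assigned by \<open>has_order\<close>.\<close>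

lemma face_sum_tile:
  assumes S: "S \<in> K" and T: "tile n S T"
  shows "face_sum T y = (\<Sum>j\<le>n + 1. if has_order T j then y ^ j * (1 + y) ^ (n + 1 - j) else 0)
    - (\<Sum>k<n. if \<exists>d S. critical_tile d k S T then y ^ k else 0)"
proof (cases "\<exists>d k S. critical_tile d k S T")
  case True
  then obtain d k S' where c: "critical_tile d k S' T" by blast
  have t: "tile d S' T" using c by (auto simp: tile_def)
  have "S' = S" "d = n" using tile_unique[OF t T] by auto
  with c have c: "critical_tile n k S T" by simp
  then have kn: "k \<le> n" by (simp add: critical_tile_def)
  have ord: "has_order T j \<longleftrightarrow> j = (if k < n then k else n + 1)" for j
  proof -
    have "has_order T j \<longleftrightarrow> (\<exists>d k S. critical_tile d k S T \<and> j = (if k < d then k else d + 1))"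
      using True by (simp add: has_order_def)
    also have "\<dots> \<longleftrightarrow> j = (if k < n then k else n + 1)"
      using c critical_tile_unique[OF c] by metis
    finally show ?thesis .
  qed
  have ind: "(\<exists>d S. critical_tile d i S T) \<longleftrightarrow> i = k" for i
    using c critical_tile_unique(2)[OF c] by metis
  show ?thesis
    unfolding face_sum_critical[OF S c] ord ind
    using kn by (cases "k < n") (auto simp: algebra_simps)
next
  case False
  then obtain k where b: "basic_tile n k S T" using T by (auto simp: tile_def)
  have pos: "0 < j" if b: "basic_tile d j S' T" for d j S'
  proof (rule ccontr)
    assume "\<not> 0 < j"
    then have "critical_tile d 0 S' T" using b basic_tile_0_critical[of d S' T] by simp
    then show False using False by blast
  qed
  have ord: "has_order T j \<longleftrightarrow> j = k" for j
  proof -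
    have "has_order T j \<longleftrightarrow> (\<exists>d S. basic_tile d j S T)"
      using False by (simp add: has_order_def)
    also have "\<dots> \<longleftrightarrow> j = k"
      using b pos basic_tile_order_unique by metis
    finally show ?thesis .
  qed
  obtain W where W: "W \<subseteq> verts S" "card W = k"
    using basic_tile_verts[OF b] by metis
  then have "card W \<le> card (verts S)" using card_mono finite_verts[OF S] by metis
  then have "k \<le> n + 1"
    using W(2) simplex_verts(3)[OF tile_simplex(1)[OF T]] by simp
  moreover have "\<not> (\<exists>d S. critical_tile d i S T)" for i using False by blast
  ultimately show ?thesis
    unfolding face_sum_basic[OF S b pos[OF b]] ord by simp
qed

lemma tile_contains_open_face:
  assumes T: "tile d S T" and S: "S \<in> K" and F: "F \<in> K" and x: "x \<in> rel_interior F" "x \<in> T"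
  shows "rel_interior F \<subseteq> T"
proof -
  note s = tile_simplex[OF T]
  have "F \<subseteq> S" using subset_of_rel_interior[OF F S x(1)] x(2) s(2) by blast
  then have sub: "verts F \<subseteq> verts S" using subset_iff_verts[OF F S] by blast
  have h: "convex hull (verts F) = F" by (rule hull_verts[OF F])
  obtain P where P: "\<And>U y. U \<subseteq> verts S \<Longrightarrow> y \<in> rel_interior (convex hull U) \<Longrightarrow> y \<in> T \<longleftrightarrow> P U"
  proof -
    consider k where "basic_tile d k S T" | k where "critical_tile d k S T"
      using T by (auto simp: tile_def)
    then show thesis
    proof cases
      case (1 k) then show thesis using basic_tile_verts that by metis
    next
      case (2 k) then show thesis using critical_tile_verts that by metis
    qed
  qed
  show ?thesis
  proof
    fix y assume "y \<in> rel_interior F"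
    then show "y \<in> T" using P[OF sub, of y] P[OF sub, of x] x unfolding h by simp
  qed
qed

end

section \<open>Tilings of manifolds use only tiles of top dimension\<close>

locale tiled_manifold = manifold_complex K n for K :: "'a::euclidean_space set set" and n +
  fixes \<tau>
  assumes tiling: "h_tiling K \<tau>"
begin

lemma tile_obtain:
  assumes "T \<in> \<tau>" obtains d S where "S \<in> K" "tile d S T"
  using assms tiling unfolding h_tiling_def by blast

lemma tile_disjoint: "T \<in> \<tau> \<Longrightarrow> T' \<in> \<tau> \<Longrightarrow> x \<in> T \<Longrightarrow> x \<in> T' \<Longrightarrow> T = T'"
  using tiling unfolding h_tiling_def partition_on_def disjoint_def by blast

lemma tile_cover: "\<Union>\<tau> = \<Union>K"
  using tiling unfolding h_tiling_def partition_on_def by blast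

text \<open>Distinct tiles have distinct underlying simplices, as each tile contains the open
  simplex of its own.\<close>

lemma finite_tiling: "finite \<tau>"
proof -
  define f where "f T = (SOME S. S \<in> K \<and> (\<exists>d. tile d S T))" for T
  have f: "f T \<in> K \<and> (\<exists>d. tile d (f T) T)" if "T \<in> \<tau>" for T
    unfolding f_def by (rule someI_ex) (use tile_obtain[OF that] in metis)
  have "inj_on f \<tau>"
  proof
    fix T T' assume T: "T \<in> \<tau>" "T' \<in> \<tau>" "f T = f T'"
    obtain d d' where t: "tile d (f T) T" "tile d' (f T) T'" using f T by metis
    have "f T \<noteq> {}" using tile_simplex(1)[OF t(1)] simplex_empty by force
    then obtain x where "x \<in> rel_interior (f T)" using rel_interior_nonempty f[OF T(1)] by metis
    then show "T = T'" using tile_simplex(3) t tile_disjoint[OF T(1,2)] by blast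
  qed
  moreover have "f ` \<tau> \<subseteq> K" using f by blast
  ultimately show ?thesis using finite_K by (rule inj_on_finite)
qed

text \<open>The tiles of least dimension form an open set, which meets the relative interior of an
  \<open>n\<close>-simplex.\<close>

lemma tile_dim_ge:
  assumes T: "T \<in> \<tau>" "S \<in> K" "tile d S T"
  shows "n \<le> d"
proof -
  define e where "e = (LEAST e. \<exists>T\<in>\<tau>. \<exists>S\<in>K. tile e S T)"
  have ex: "\<exists>T\<in>\<tau>. \<exists>S\<in>K. tile e S T"
    unfolding e_def by (rule LeastI[of _ d]) (use T in blast)
  have e_le: "e \<le> e'" if "T \<in> \<tau>" "S \<in> K" "tile e' S T" for e' T S
    unfolding e_def by (rule Least_le) (use that in blast)
  obtain T0 S0 where T0: "T0 \<in> \<tau>" "S0 \<in> K" "tile e S0 T0" using ex by blast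
  let ?C = "\<Union>{T\<in>\<tau>. \<exists>e'>e. \<exists>S\<in>K. tile e' S T}"
  have "closedin (top_of_set (\<Union>K)) ?C"
    using tiling unfolding h_tiling_def by blast
  then obtain D where D: "closed D" "?C = \<Union>K \<inter> D" unfolding closedin_closed by blast
  have "S0 \<noteq> {}" using tile_simplex(1)[OF T0(3)] simplex_empty by force
  then obtain y where y: "y \<in> rel_interior S0" using rel_interior_nonempty T0(2) by metis
  have yT: "y \<in> T0" using y tile_simplex(3)[OF T0(3)] by blast
  have "y \<notin> ?C"
  proof
    assume "y \<in> ?C"
    then obtain T1 e1 S1 where 1: "T1 \<in> \<tau>" "y \<in> T1" "e < e1" "tile e1 S1 T1" by blast
    have "T1 = T0" using tile_disjoint[OF 1(1) T0(1) 1(2) yT] .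
    then have "e1 = e" using tile_unique(2)[OF 1(4)] T0(3) by blast
    then show False using 1(3) by simp
  qed
  moreover have "y \<in> \<Union>K" using yT T0(1) tile_cover by blast
  ultimately have yD: "y \<in> - D" using D(2) by blast
  obtain G where G: "G \<in> K" "S0 \<subseteq> G" "aff_dim G = int n"
    using ex_facet[OF T0(2) \<open>S0 \<noteq> {}\<close>] by metis
  have "y \<in> G" using y G(2) rel_interior_subset[of S0] by blast
  \<comment> \<open>The open simplex of \<open>G\<close> accumulates at \<open>y\<close>, while the
    complement of \<open>D\<close> is a neighbourhood of \<open>y\<close>. So some interior point
    \<open>z\<close> of \<open>G\<close> lies in a tile of dimension at most \<open>e\<close>; the
    simplex of that tile contains \<open>G\<close>, whence \<open>n \<le> e\<close>.\<close>
  then have "y \<in> closure (rel_interior G)"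
    using convex_closure_rel_interior[OF convex_K[OF G(1)]] closure_subset[of G] by auto
  then have "- D \<inter> rel_interior G \<noteq> {}"
    using yD open_Int_closure_eq_empty[of "- D" "rel_interior G"] D(1) by (simp add: open_Compl) blast
  then obtain z where z: "z \<notin> D" "z \<in> rel_interior G" by blast
  have "z \<in> \<Union>K" using z(2) G(1) rel_interior_subset[of G] by blast
  then have zC: "z \<notin> ?C" using z(1) D(2) by blast
  obtain T1 where T1: "T1 \<in> \<tau>" "z \<in> T1" using \<open>z \<in> \<Union>K\<close> tile_cover by blast
  obtain e1 S1 where S1: "S1 \<in> K" "tile e1 S1 T1" using tile_obtain[OF T1(1)] by metis
  have "\<not> e < e1" using zC T1 S1 by blast
  moreover have "G \<subseteq> S1"
    using subset_of_rel_interior[OF G(1) S1(1) z(2)] T1(2) tile_simplex(2)[OF S1(2)] by blast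
  then have "int n \<le> int e1"
    using aff_dim_subset[of G S1] G(3) aff_dim_simplex[OF tile_simplex(1)[OF S1(2)]] by simp
  ultimately show ?thesis using e_le[OF T] by simp
qed

lemma tile_dim:
  assumes T: "T \<in> \<tau>" obtains S where "S \<in> K" "tile n S T"
proof -
  obtain d S where S: "S \<in> K" "tile d S T" using tile_obtain[OF T] by metis
  have "d = n"
    using tile_dim_ge[OF T S] aff_dim_le[OF S(1)] aff_dim_simplex[OF tile_simplex(1)[OF S(2)]] by simp
  then show thesis using that S by blast
qed

section \<open>The face polynomial and its Dehn-Sommerville relation\<close>

definition face_poly :: "real \<Rightarrow> real" where
  "face_poly y = (\<Sum>F\<in>K - {{}}. y ^ card (verts F))"

text \<open>A tile meeting an open face contains it, so the tiles partition the nonempty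
  faces.\<close>

lemma face_poly_tiles: "face_poly y = (\<Sum>T\<in>\<tau>. face_sum T y)"
proof -
  let ?A = "\<lambda>T. {F. F \<in> K - {{}} \<and> rel_interior F \<subseteq> T}"
  have cover: "K - {{}} = (\<Union>T\<in>\<tau>. ?A T)"
  proof
    show "K - {{}} \<subseteq> (\<Union>T\<in>\<tau>. ?A T)"
    proof
      fix F assume F: "F \<in> K - {{}}"
      then obtain x where x: "x \<in> rel_interior F" using rel_interior_nonempty by (metis DiffD1 DiffD2 singletonI)
      then have "x \<in> \<Union>K" using F rel_interior_subset[of F] by blast
      then obtain T where T: "T \<in> \<tau>" "x \<in> T" using tile_cover by blast
      obtain S where "S \<in> K" "tile n S T" using tile_dim[OF T(1)] by metis
      then have "rel_interior F \<subseteq> T" using tile_contains_open_face F x T(2) by (metis DiffD1)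
      then show "F \<in> (\<Union>T\<in>\<tau>. ?A T)" using F T(1) by blast
    qed
  qed blast
  have disj: "?A T \<inter> ?A T' = {}" if T: "T \<in> \<tau>" "T' \<in> \<tau>" "T \<noteq> T'" for T T'
  proof (rule equals0I)
    fix F assume F: "F \<in> ?A T \<inter> ?A T'"
    then obtain x where "x \<in> rel_interior F" using rel_interior_nonempty[of F] by auto
    then show False using F tile_disjoint[OF T(1,2)] T(3) by blast
  qed
  have "face_poly y = (\<Sum>F\<in>(\<Union>T\<in>\<tau>. ?A T). y ^ card (verts F))"
    unfolding face_poly_def cover[symmetric] ..
  also have "\<dots> = (\<Sum>T\<in>\<tau>. \<Sum>F\<in>?A T. y ^ card (verts F))"
    by (rule sum.UNION_disjoint) (use finite_tiling finite_K disj in auto)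
  finally show ?thesis unfolding face_sum_def .
qed

lemma face_poly_h_num:
  "face_poly y = (\<Sum>j\<le>n + 1. real (h_num \<tau> j) * (y ^ j * (1 + y) ^ (n + 1 - j)))
    - (\<Sum>k<n. real (c_num \<tau> k) * y ^ k)"
proof -
  have count: "(\<Sum>T\<in>\<tau>. if Q T then c else 0) = real (card {T\<in>\<tau>. Q T}) * c" for Q and c :: real
    using finite_tiling by (simp add: sum.If_cases Int_def)
  have "face_poly y = (\<Sum>T\<in>\<tau>. (\<Sum>j\<le>n + 1. if has_order T j then y ^ j * (1 + y) ^ (n + 1 - j) else 0)
    - (\<Sum>k<n. if \<exists>d S. critical_tile d k S T then y ^ k else 0))"
    unfolding face_poly_tiles
  proof (rule sum.cong[OF refl])
    fix T assume "T \<in> \<tau>"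
    then obtain S where "S \<in> K" "tile n S T" using tile_dim by metis
    then show "face_sum T y = (\<Sum>j\<le>n + 1. if has_order T j then y ^ j * (1 + y) ^ (n + 1 - j) else 0)
        - (\<Sum>k<n. if \<exists>d S. critical_tile d k S T then y ^ k else 0)"
      by (rule face_sum_tile)
  qed
  also have "\<dots> = (\<Sum>j\<le>n + 1. \<Sum>T\<in>\<tau>. if has_order T j then y ^ j * (1 + y) ^ (n + 1 - j) else 0)
    - (\<Sum>k<n. \<Sum>T\<in>\<tau>. if \<exists>d S. critical_tile d k S T then y ^ k else 0)"
    unfolding sum_subtractf by (subst (1 2) sum.swap) simp
  finally show ?thesis unfolding count h_num_def c_num_def .
qed

text \<open>The summand 1 is the share of the empty face; it is the source of the Euler
  characteristic in \<open>Dehn_Sommerville\<close>.\<close>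

lemma sum_pow_faces:
  fixes y :: real
  assumes G: "G \<in> K - {{}}"
  shows "(1 + y) ^ card (verts G) = 1 + (\<Sum>F | F \<in> K - {{}} \<and> F \<subseteq> G. y ^ card (verts F))"
proof -
  have GK: "G \<in> K" using G by blast
  have fin: "finite (verts G)" by (rule finite_verts[OF GK])
  have "(1 + y) ^ card (verts G) = (\<Sum>U | U \<subseteq> verts G. y ^ card U)"
    using sum_pow_card_supersets[of "verts G" "{}" y] fin by simp
  also have "\<dots> = y ^ card ({} :: 'a set) + (\<Sum>U\<in>{U. U \<subseteq> verts G} - {{}}. y ^ card U)"
    using fin by (intro sum.remove) auto
  also have "(\<Sum>U\<in>{U. U \<subseteq> verts G} - {{}}. y ^ card U)
      = (\<Sum>F | F \<in> K - {{}} \<and> F \<subseteq> G. y ^ card (verts F))"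
  proof (rule sum.reindex_bij_witness[of _ verts "\<lambda>U. convex hull U"])
    fix U assume U: "U \<in> {U. U \<subseteq> verts G} - {{}}"
    then have h: "convex hull U \<in> K" "verts (convex hull U) = U"
      using hull_subset_K[OF GK] by auto
    show "verts (convex hull U) = U" by (rule h)
    then show "y ^ card (verts (convex hull U)) = y ^ card U" by simp
    have "convex hull U \<subseteq> G" using subset_iff_verts[OF h(1) GK] h(2) U by blast
    then show "convex hull U \<in> {F. F \<in> K - {{}} \<and> F \<subseteq> G}" using h U by simp
  next
    fix F assume F: "F \<in> {F. F \<in> K - {{}} \<and> F \<subseteq> G}"
    then show "convex hull (verts F) = F" by (intro hull_verts) blast
    show "verts F \<in> {U. U \<subseteq> verts G} - {{}}"
      using F subset_iff_verts[OF _ GK, of F] verts_nonempty[of F] by simp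
  qed
  finally show ?thesis by simp
qed

lemma neg1_pow_card:
  assumes "G \<in> K - {{}}"
  shows "(-1 :: real) ^ card (verts G) = - of_int ((-1) ^ nat (aff_dim G))"
proof -
  have GK: "G \<in> K" "G \<noteq> {}" using assms by auto
  obtain d where d: "aff_dim G = int d" using aff_dim_nat[OF GK] by metis
  then have "card (verts G) = Suc d" using card_verts[OF GK(1)] by simp
  then show ?thesis by (simp add: d)
qed

text \<open>Writing \<open>-1 - y\<close> as \<open>-1 * (1 + y)\<close> expands each power over the
  faces \<open>F\<close> of \<open>G\<close>. Exchanging the sums leaves, for each \<open>F\<close>,
  the signed count of simplices above it; since the exponent is the dimension plus one, this is the
  negative of \<open>local_euler_char\<close>.\<close>

lemma Dehn_Sommerville: "face_poly (-1 - y) = - ((-1) ^ n * face_poly y) - of_int (euler_char K)"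
proof -
  let ?K = "K - {{}}"
  have finK: "finite ?K" using finite_K by simp
  let ?s = "\<lambda>G. (-1 :: real) ^ card (verts G)"
  have s_sum: "(\<Sum>G | G \<in> ?K \<and> F \<subseteq> G. ?s G) = - ((-1) ^ n)" if F: "F \<in> ?K" for F
  proof -
    have eq: "{G. G \<in> ?K \<and> F \<subseteq> G} = {G. G \<in> K \<and> F \<subseteq> G}" using F by auto
    have "(\<Sum>G | G \<in> ?K \<and> F \<subseteq> G. ?s G) = (\<Sum>G | G \<in> ?K \<and> F \<subseteq> G. - of_int ((-1) ^ nat (aff_dim G)))"
      by (rule sum.cong[OF refl]) (use neg1_pow_card in blast)
    also have "\<dots> = - of_int (\<Sum>G | G \<in> K \<and> F \<subseteq> G. (-1) ^ nat (aff_dim G))"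
      unfolding eq by (simp add: sum_negf)
    also have "\<dots> = - ((-1) ^ n)"
      using local_euler_char[of F] F by simp
    finally show ?thesis .
  qed
  have chi: "(\<Sum>G\<in>?K. ?s G) = - of_int (euler_char K)"
  proof -
    have "(\<Sum>G\<in>?K. ?s G) = (\<Sum>G\<in>?K. - of_int ((-1) ^ nat (aff_dim G)))"
      by (rule sum.cong[OF refl neg1_pow_card])
    then show ?thesis unfolding euler_char_def by (simp add: sum_negf)
  qed
  have "face_poly (-1 - y) = (\<Sum>G\<in>?K. ?s G * (1 + y) ^ card (verts G))"
    unfolding face_poly_def
  proof (rule sum.cong[OF refl])
    fix G
    have "-1 - y = -1 * (1 + y)" by simp
    then show "(-1 - y) ^ card (verts G) = ?s G * (1 + y) ^ card (verts G)"
      by (metis power_mult_distrib)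
  qed
  also have "\<dots> = (\<Sum>G\<in>?K. ?s G + (\<Sum>F | F \<in> ?K \<and> F \<subseteq> G. ?s G * y ^ card (verts F)))"
    by (rule sum.cong[OF refl]) (simp only: sum_pow_faces distrib_left mult_1_right sum_distrib_left)
  also have "\<dots> = (\<Sum>G\<in>?K. ?s G) + (\<Sum>G\<in>?K. \<Sum>F | F \<in> ?K \<and> F \<subseteq> G. ?s G * y ^ card (verts F))"
    by (rule sum.distrib)
  also have "(\<Sum>G\<in>?K. \<Sum>F | F \<in> ?K \<and> F \<subseteq> G. ?s G * y ^ card (verts F))
      = (\<Sum>F\<in>?K. \<Sum>G | G \<in> ?K \<and> F \<subseteq> G. ?s G * y ^ card (verts F))"
    by (rule sum.swap_restrict[OF finK finK])
  also have "\<dots> = (\<Sum>F\<in>?K. - ((-1) ^ n) * y ^ card (verts F))"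
    by (rule sum.cong[OF refl]) (simp only: s_sum flip: sum_distrib_right)
  also have "\<dots> = - ((-1) ^ n) * face_poly y"
    unfolding face_poly_def by (rule sum_distrib_left[symmetric])
  finally show ?thesis unfolding chi by simp
qed

text \<open>The substitution exchanges 0 and -1, and \<open>face_poly\<close> vanishes at 0. For odd
  \<open>n\<close> this says that the Euler characteristic is 0.\<close>

lemma euler_char_sign: "(-1) ^ n * of_int (euler_char K) = (of_int (euler_char K) :: real)"
proof -
  have zero: "face_poly 0 = 0"
    unfolding face_poly_def
  proof (rule sum.neutral, rule ballI)
    fix F assume F: "F \<in> K - {{}}"
    then have "card (verts F) \<noteq> 0" using verts_nonempty[of F] finite_verts[of F] by simp
    then show "(0::real) ^ card (verts F) = 0" by simp
  qed
  have "face_poly (-1) = - of_int (euler_char K)"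
    using Dehn_Sommerville[of 0] zero by simp
  moreover have "0 = - ((-1) ^ n * face_poly (-1)) - of_int (euler_char K)"
    using Dehn_Sommerville[of "-1"] zero by simp
  ultimately show ?thesis by simp
qed

text \<open>With \<open>X = y / (1 + y)\<close> the relation between \<open>face_poly y\<close> and the
  \<open>h\<close>-numbers lets us split \<open>P\<close> into summands that are palindromic separately;
  replacing \<open>X\<close> by \<open>1 / X\<close> amounts to replacing \<open>y\<close> by \<open>-1 - y\<close>.\<close>

lemma poly_tiling_poly:
  assumes "X \<noteq> 1"
  shows "poly (tiling_poly n K \<tau>) X =
    (1 - X) ^ (n + 1) * (face_poly (X / (1 - X)) + of_int (euler_char K) / 2)
    + (\<Sum>j<n. real (c_num \<tau> j) * ((1 - X) ^ (n + 1 - j) * (X ^ j + (-1) ^ (n + 1 - j))))"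
proof -
  define q where "q = 1 - X"
  have q: "q \<noteq> 0" using assms by (simp add: q_def)
  have q1: "1 + X / q = 1 / q" using q by (simp add: q_def field_simps)
  have pw: "q ^ (n + 1) = q ^ j * q ^ (n + 1 - j)" if "j \<le> n + 1" for j
    using that by (simp flip: power_add)
  have H: "q ^ (n + 1) * (\<Sum>j\<le>n + 1. real (h_num \<tau> j) * ((X / q) ^ j * (1 + X / q) ^ (n + 1 - j)))
      = (\<Sum>j\<le>n + 1. real (h_num \<tau> j) * X ^ j)"
    unfolding sum_distrib_left q1
  proof (rule sum.cong[OF refl])
    fix j assume "j \<in> {..n + 1}"
    then show "q ^ (n + 1) * (real (h_num \<tau> j) * ((X / q) ^ j * (1 / q) ^ (n + 1 - j))) = real (h_num \<tau> j) * X ^ j"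
      using pw[of j] q by (simp add: power_divide field_simps)
  qed
  have C: "q ^ (n + 1) * (\<Sum>k<n. real (c_num \<tau> k) * (X / q) ^ k)
      = (\<Sum>k<n. real (c_num \<tau> k) * (q ^ (n + 1 - k) * X ^ k))"
    unfolding sum_distrib_left
  proof (rule sum.cong[OF refl])
    fix j assume "j \<in> {..<n}"
    then show "q ^ (n + 1) * (real (c_num \<tau> j) * (X / q) ^ j) = real (c_num \<tau> j) * (q ^ (n + 1 - j) * X ^ j)"
      using pw[of j] q by (simp add: power_divide)
  qed
  \<comment> \<open>With \<open>k = n + 1 - j\<close> the range from 2 to \<open>n + 1\<close>
    corresponds to \<open>j < n\<close>, the range of the correction in
    \<open>face_poly_h_num\<close>.\<close>
  have D: "(\<Sum>k=2..n + 1. real (c_num \<tau> (n + 1 - k)) * (X - 1) ^ k)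
      = (\<Sum>j<n. real (c_num \<tau> j) * (q ^ (n + 1 - j) * (-1) ^ (n + 1 - j)))"
  proof (rule sum.reindex_bij_witness[of _ "\<lambda>j. n + 1 - j" "\<lambda>k. n + 1 - k"])
    fix k assume "k \<in> {2..n + 1}"
    then have "n + 1 - (n + 1 - k) = k" by auto
    moreover have "(X - 1) ^ k = q ^ k * (-1) ^ k"
      unfolding q_def by (simp flip: power_mult_distrib)
    ultimately show "real (c_num \<tau> (n + 1 - k)) * (q ^ (n + 1 - (n + 1 - k)) * (-1) ^ (n + 1 - (n + 1 - k)))
        = real (c_num \<tau> (n + 1 - k)) * (X - 1) ^ k"
      by simp
  qed auto
  have E: "(\<Sum>j<n. real (c_num \<tau> j) * (q ^ (n + 1 - j) * (X ^ j + (-1) ^ (n + 1 - j))))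
    = (\<Sum>k<n. real (c_num \<tau> k) * (q ^ (n + 1 - k) * X ^ k))
      + (\<Sum>j<n. real (c_num \<tau> j) * (q ^ (n + 1 - j) * (-1) ^ (n + 1 - j)))"
    by (simp add: distrib_left sum.distrib)
  have F: "q ^ (n + 1) * face_poly (X / q) = (\<Sum>j\<le>n + 1. real (h_num \<tau> j) * X ^ j)
      - (\<Sum>k<n. real (c_num \<tau> k) * (q ^ (n + 1 - k) * X ^ k))"
    unfolding face_poly_h_num right_diff_distrib H C ..
  have "poly (tiling_poly n K \<tau>) X = (\<Sum>k=0..n + 1. real (h_num \<tau> k) * X ^ k)
      + (\<Sum>k=2..n + 1. real (c_num \<tau> (n + 1 - k)) * (X - 1) ^ k)
      + of_int (euler_char K) / 2 * q ^ (n + 1)"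
    by (simp add: tiling_poly_def poly_sum q_def del: power_Suc sum.cl_ivl_Suc sum.atLeast0_atMost_Suc)
  then show ?thesis
    unfolding q_def[symmetric] D E distrib_left[of "q ^ (n + 1)"] F atLeast0AtMost
    unfolding mult.commute[of "q ^ (n + 1)" "of_int (euler_char K) / 2"] by linarith
qed

text \<open>The case \<open>X = 1\<close> is immediate from \<open>1 / X = X\<close> and is split
  off because the substitution divides by \<open>1 - X\<close>.\<close>

lemma tiling_poly_palindromic:
  assumes "X \<noteq> 0"
  shows "X ^ (n + 1) * poly (tiling_poly n K \<tau>) (1 / X) = poly (tiling_poly n K \<tau>) X"
proof (cases "X = 1")
  case False
  define q where "q = 1 - X"
  have q: "q \<noteq> 0" using False by (simp add: q_def)
  have iq: "1 - 1 / X = - q / X" using assms by (simp add: q_def field_simps)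
  have arg: "1 / X / (- q / X) = -1 - X / q" using assms q by (simp add: q_def field_simps)
  have iX: "1 / X \<noteq> 1" using False assms by (simp add: field_simps)
  have 1: "X ^ (n + 1) * ((- q / X) ^ (n + 1) * (face_poly (-1 - X / q) + of_int (euler_char K) / 2))
      = q ^ (n + 1) * (face_poly (X / q) + of_int (euler_char K) / 2)"
  proof -
    have "X ^ (n + 1) * (- q / X) ^ (n + 1) = (-1) ^ (n + 1) * q ^ (n + 1)"
      using assms by (simp flip: power_mult_distrib)
    \<comment> \<open>By \<open>euler_char_sign\<close>, adding half the Euler characteristic turns
      \<open>Dehn_Sommerville\<close> into a pure sign change by \<open>(-1) ^ (n + 1)\<close>. It
      cancels the sign coming from \<open>(- q / X) ^ (n + 1)\<close>.\<close>
    moreover have "(-1) ^ (n + 1) * (face_poly (-1 - X / q) + of_int (euler_char K) / 2)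
        = face_poly (X / q) + of_int (euler_char K) / 2"
    proof -
      have "(-1) ^ n * ((-1) ^ n * face_poly (X / q)) = face_poly (X / q)"
        by (simp flip: mult.assoc power_add)
      then show ?thesis
        unfolding Dehn_Sommerville using euler_char_sign by (simp add: algebra_simps)
    qed
    ultimately show ?thesis by (metis mult.assoc mult.commute)
  qed
  \<comment> \<open>As the exponents \<open>j\<close> and \<open>m = n + 1 - j\<close> add up to
    \<open>n + 1\<close>, the reversal exchanges \<open>q ^ m * X ^ j\<close> and
    \<open>q ^ m * (-1) ^ m\<close>.\<close>
  have 2: "X ^ (n + 1) * ((- q / X) ^ (n + 1 - j) * ((1 / X) ^ j + (-1) ^ (n + 1 - j)))
      = q ^ (n + 1 - j) * (X ^ j + (-1) ^ (n + 1 - j))" if j: "j < n" for j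
  proof -
    define m where "m = n + 1 - j"
    have nm: "n + 1 = j + m" using j by (simp add: m_def)
    have "X ^ (j + m) * ((- q / X) ^ m * ((1 / X) ^ j + (-1) ^ m))
        = (X * (- q / X)) ^ m * (X * (1 / X)) ^ j + (X * (- q / X)) ^ m * X ^ j * (-1) ^ m"
      by (simp only: power_add power_mult_distrib) (simp add: algebra_simps)
    also have "\<dots> = (- q) ^ m * (1 + X ^ j * (-1) ^ m)"
      using assms by (simp add: algebra_simps)
    also have "(- q) ^ m = q ^ m * (-1) ^ m"
      by (simp flip: power_mult_distrib)
    also have "q ^ m * (-1) ^ m * (1 + X ^ j * (-1) ^ m) = q ^ m * (X ^ j * ((-1) ^ m * (-1) ^ m) + (-1) ^ m)"
      by (simp add: algebra_simps)
    also have "(-1) ^ m * (-1) ^ m = (1::real)" by (simp flip: power_add)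
    finally show ?thesis unfolding nm m_def[symmetric] by simp
  qed
  have 3: "X ^ (n + 1) * (\<Sum>j<n. real (c_num \<tau> j) * ((- q / X) ^ (n + 1 - j) * ((1 / X) ^ j + (-1) ^ (n + 1 - j))))
      = (\<Sum>j<n. real (c_num \<tau> j) * (q ^ (n + 1 - j) * (X ^ j + (-1) ^ (n + 1 - j))))"
    unfolding sum_distrib_left
  proof (rule sum.cong[OF refl])
    fix j assume "j \<in> {..<n}"
    then have j: "j < n" by simp
    show "X ^ (n + 1) * (real (c_num \<tau> j) * ((- q / X) ^ (n + 1 - j) * ((1 / X) ^ j + (-1) ^ (n + 1 - j))))
        = real (c_num \<tau> j) * (q ^ (n + 1 - j) * (X ^ j + (-1) ^ (n + 1 - j)))"
      using 2[OF j] by (metis mult.left_commute)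
  qed
  show ?thesis
    unfolding poly_tiling_poly[OF iX] poly_tiling_poly[OF False] iq q_def[symmetric] arg distrib_left[of "X ^ (n + 1)"] 1 3 ..
qed simp

end

theorem theorem1p7:
  fixes n :: nat and K :: "'a::euclidean_space set set" and \<tau> :: "'a set set"
  assumes "homology_manifold n K"
    and "h_tiling K \<tau>"
  shows "\<forall>x::real. x \<noteq> 0 \<longrightarrow>
    x ^ (n + 1) * poly (tiling_poly n K \<tau>) (1 / x) = poly (tiling_poly n K \<tau>) x"
proof -
  interpret tiled_manifold K n \<tau>
    using assms by unfold_locales (auto simp: homology_manifold_def)
  show ?thesis using tiling_poly_palindromic by blast
qed

end
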